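(* Let $\mathbb{X}$ be a finite-dimensional real inner product space, $T:\mathbb{X}\rightrightarrows\mathbb{X}$ a maximal monotone operator, and $x^*\in T^{-1}(0)$ arbitrary. Let $\{(x^k,y^k,v^k)\}$ and $\{\epsilon_k\}$ be generated by the VMOR-HPE framework (defined in the context) applied to $T$, and let $\Xi=\prod_{i=0}^\infty(1+\xi_i)$. Let $k\ge1$. (i) There exists an integer $k_0\in\{1,2,\ldots,k\}$ such that $v^{k_0}\in T^{[\epsilon_{k_0}]}(y^{k_0})$ with $\epsilon_{k_0}\ge0$ and $$\|v^{k_0}\|\le\sqrt{\frac{4(1+\sum_{i=1}^k\xi_i)\Xi^2\overline{\omega}}{k(1-\sigma)(1+\underline{\theta})^3\underline{c}^2}}\,\|x^0-x^*\|_{\mathcal{M}_0},\qquad \epsilon_{k_0}\le\frac{(1+\sum_{i=1}^k\xi_i)\Xi}{k(1-\sigma)(1+\underline{\theta})^2\underline{c}}\,\|x^0-x^*\|_{\mathcal{M}_0}^2 .$$ (ii) Let $\{\alpha_k\}$ be a nonnegative weight sequence with $\sum_{i=1}^k\alpha_i>0$. Put $\tau_i=(1+\theta_i)c_i$ and $$\overline{y}^k=\frac{\sum_{i=1}^k\tau_i\alpha_iy^i}{\sum_{i=1}^k\tau_i\alpha_i},\quad \overline{v}^k=\frac{\sum_{i=1}^k\tau_i\alpha_iv^i}{\sum_{i=1}^k\tau_i\alpha_i},\quad \overline{\epsilon}_k=\frac{\sum_{i=1}^k\tau_i\alpha_i\big(\epsilon_i+\langle y^i-\overline{y}^k,v^i-\overline{v}^k\rangle\big)}{\sum_{i=1}^k\tau_i\alpha_i}.$$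 Then $\overline{v}^k\in T^{[\overline{\epsilon}_k]}(\overline{y}^k)$ with $\overline{\epsilon}_k\ge0$. Moreover, if $\mathcal{M}_k\preceq(1+\xi_k)\mathcal{M}_{k+1}$ for all $k$, then $$\|\overline{v}^k\|\le\frac{\max_{1\le i\le k}\{\alpha_{i+1}\}\sum_{i=1}^k\xi_i+\sum_{i=1}^k|\alpha_i-\alpha_{i+1}|+\alpha_{k+1}+\alpha_1}{\underline{c}(1+\underline{\theta})\sum_{i=1}^k\alpha_i}\,M,$$ $$\overline{\epsilon}_k\le\frac{(10+\underline{\theta})\max_{1\le i\le k}\{\alpha_i\}\big(1+\sum_{i=1}^k\xi_i\big)+(2+\underline{\theta})\sum_{i=1}^k|\alpha_{i+1}-\alpha_i|}{\underline{c}(1+\underline{\theta})^2\sum_{i=1}^k\alpha_i}\,B,$$ where $M=\Xi\overline{\omega}\big[\|x^*\|+\sqrt{\Xi/\underline{\omega}}\,\|x^0-x^*\|_{\mathcal{M}_0}\big]$ and $$B=\max\Big\{M,\ \Xi\|x^*\|^2+\tfrac{\Xi^2}{\underline{\omega}}\|x^0-x^*\|_{\mathcal{M}_0}^2,\ \tfrac{\Xi^2}{(1-\sigma)\underline{\omega}}\|x^0-x^*\|_{\mathcal{M}_0}^2,\ \tfrac{\Xi}{1-\sigma}\|x^0-x^*\|_{\mathcal{M}_0}^2\Big\}.$$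
   Context: Notation. For a self-adjoint positive definite linear operator $\mathcal{M}$ on $\mathbb{X}$, $\|x\|_{\mathcal{M}}=\sqrt{\langle x,\mathcal{M}x\rangle}$; $\preceq$ is the Loewner order; $\mathcal{I}$ is the identity. For $\epsilon\ge 0$ the $\epsilon$-enlargement of $T$ is $T^{[\epsilon]}(x)=\{v\in\mathbb{X}\mid \langle w-v,z-x\rangle\ge-\epsilon\ \ \forall z\in\mathbb{X},\ \forall w\in T(z)\}$, and $\mathrm{gph}\,T^{[\epsilon]}=\{(x,v)\mid v\in T^{[\epsilon]}(x)\}$. VMOR-HPE framework. Parameters: $\underline{\omega},\overline{\omega}>0$, $\underline{\theta}>-1$, $\sigma\in[0,1)$, $\underline{c}>0$, $\xi_k\ge 0$ with $\sum_k\xi_k<\infty$; a self-adjoint operator $\mathcal{M}_0$ with $\underline{\omega}\mathcal{I}\preceq\mathcal{M}_0\preceq\overline{\omega}\mathcal{I}$; a starting point $x^0\in\mathbb{X}$. For $k=0,1,2,\ldots$: choose $c_k\ge\underline{c}$ and $\theta_k\in[\underline{\theta},\infty)$; find $(\epsilon_k,y^k,v^k)\in\mathbb{R}_+\times\mathbb{X}\times\mathbb{X}$ satisfying (a) $(y^k,v^k)\in\mathrm{gph}\,T^{[\epsilon_k]}$, (b) $\theta_k\|c_k\mathcal{M}_k^{-1}v^k\|_{\mathcal{M}_k}^2+\|c_k\mathcal{M}_k^{-1}v^k+(y^k-x^k)\|_{\mathcal{M}_k}^2+2c_k\epsilon_k\le\sigma\|y^k-x^k\|_{\mathcal{M}_k}^2$;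 set $x^{k+1}=x^k-(1+\theta_k)c_k\mathcal{M}_k^{-1}v^k$; choose a self-adjoint operator $\mathcal{M}_{k+1}$ with $\underline{\omega}\mathcal{I}\preceq\mathcal{M}_{k+1}\preceq(1+\xi_k)\mathcal{M}_k$. *)

theory Defs
  imports "HOL-Analysis.Analysis"
begin

definition self_adjoint :: "('a::real_inner \<Rightarrow> 'a) \<Rightarrow> bool" where
  "self_adjoint A \<longleftrightarrow> linear A \<and> adjoint A = A"

text \<open>The Loewner order; it is only applied to self-adjoint operators below.\<close>

definition loewner_le :: "('a::real_inner \<Rightarrow> 'a) \<Rightarrow> ('a \<Rightarrow> 'a) \<Rightarrow> bool" (infix "\<preceq>" 50) where
  "A \<preceq> B \<longleftrightarrow> (\<forall>x. 0 \<le> x \<bullet> (B x - A x))"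

definition norm_op :: "('a::real_inner \<Rightarrow> 'a) \<Rightarrow> 'a \<Rightarrow> real" where
  "norm_op A x = sqrt (x \<bullet> A x)"

text \<open>Set-valued operators are functions into sets; the value may be empty.\<close>

definition gph :: "('a \<Rightarrow> 'b set) \<Rightarrow> ('a \<times> 'b) set" where
  "gph T = {(x, v). v \<in> T x}"

definition monotone_operator :: "('a::real_inner \<Rightarrow> 'a set) \<Rightarrow> bool" where
  "monotone_operator T \<longleftrightarrow>
     (\<forall>(x, u) \<in> gph T. \<forall>(y, w) \<in> gph T. 0 \<le> (u - w) \<bullet> (x - y))"

definition maximal_monotone :: "('a::real_inner \<Rightarrow> 'a set) \<Rightarrow> bool" where
  "maximal_monotone T \<longleftrightarrow> monotone_operator T \<and>
     (\<forall>S. monotone_operator S \<and> gph T \<subseteq> gph S \<longrightarrow> gph S = gph T)"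

definition enlargement :: "('a::real_inner \<Rightarrow> 'a set) \<Rightarrow> real \<Rightarrow> 'a \<Rightarrow> 'a set" where
  "enlargement T \<epsilon> x = {v. \<forall>z. \<forall>w \<in> T z. (w - v) \<bullet> (z - x) \<ge> - \<epsilon>}"

text \<open>
  The locale describes all the sequences that the framework can generate: the choices made in
  every iteration are given as sequences, and the assumptions are the requirements on them.
  Since every \<open>\<M> k\<close> is bounded below by a positive multiple of the identity, it is a bijection
  and \<open>inv (\<M> k)\<close> is its inverse operator.
\<close>

locale vmor_hpe =
  fixes T :: "'a::euclidean_space \<Rightarrow> 'a set"
    and \<omega>\<^sub>l \<omega>\<^sub>u \<theta>\<^sub>l \<sigma> c\<^sub>l :: real
    and \<xi> :: "nat \<Rightarrow> real"
    and \<M> :: "nat \<Rightarrow> 'a \<Rightarrow> 'a"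
    and c \<theta> \<epsilon> :: "nat \<Rightarrow> real"
    and x y v :: "nat \<Rightarrow> 'a"
  assumes omega_l_pos: "\<omega>\<^sub>l > 0"
    and omega_u_pos: "\<omega>\<^sub>u > 0"
    and theta_l: "\<theta>\<^sub>l > -1"
    and sigma: "0 \<le> \<sigma>" "\<sigma> < 1"
    and c_l_pos: "c\<^sub>l > 0"
    and xi_nonneg: "\<And>k. \<xi> k \<ge> 0"
    and xi_summable: "summable \<xi>"
    and M_self_adjoint: "\<And>k. self_adjoint (\<M> k)"
    and M_0_lower: "(\<lambda>z. \<omega>\<^sub>l *\<^sub>R z) \<preceq> \<M> 0"
    and M_0_upper: "\<M> 0 \<preceq> (\<lambda>z. \<omega>\<^sub>u *\<^sub>R z)"
    and c_ge: "\<And>k. c k \<ge> c\<^sub>l"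
    and theta_ge: "\<And>k. \<theta> k \<ge> \<theta>\<^sub>l"
    and eps_nonneg: "\<And>k. \<epsilon> k \<ge> 0"
    and inclusion: "\<And>k. (y k, v k) \<in> gph (enlargement T (\<epsilon> k))"
    and error_criterion: "\<And>k.
          \<theta> k * (norm_op (\<M> k) (c k *\<^sub>R inv (\<M> k) (v k)))\<^sup>2
          + (norm_op (\<M> k) (c k *\<^sub>R inv (\<M> k) (v k) + (y k - x k)))\<^sup>2
          + 2 * c k * \<epsilon> k
          \<le> \<sigma> * (norm_op (\<M> k) (y k - x k))\<^sup>2"
    and step: "\<And>k. x (Suc k) = x k - ((1 + \<theta> k) * c k) *\<^sub>R inv (\<M> k) (v k)"
    and M_Suc_lower: "\<And>k. (\<lambda>z. \<omega>\<^sub>l *\<^sub>R z) \<preceq> \<M> (Suc k)"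
    and M_Suc_upper: "\<And>k. \<M> (Suc k) \<preceq> (\<lambda>z. (1 + \<xi> k) *\<^sub>R \<M> k z)"

end

theory Submission
  imports Defs
begin

text \<open>
  Write \<open>d k = y k - x k\<close>, let \<open>D\<close> be the initial distance to \<open>xs\<close>, and measure everything of
  iteration \<open>k\<close> in the norm of \<open>\<M> k\<close>.
  Expanding the square of the distance from the new iterate to an arbitrary point \<open>z\<close> and inserting
  the error criterion gives one inequality (\<open>energy_decrease\<close>): \<open>\<epsilon> k + v k \<bullet> (y k - z)\<close> is controlled
  by the decrease of the squared distance to \<open>z\<close>, with the residual \<open>d k\<close> to spare.  Everything
  follows from two choices of \<open>z\<close>.

  For \<open>z = xs\<close> the pairing is bounded below by \<open>- \<epsilon> k\<close>, because \<open>xs\<close> is a zero.  Hence within an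
  iteration the distance to \<open>xs\<close> cannot grow, and a change of metric multiplies its square by at
  most \<open>1 + \<xi> k\<close>.  So the squared distances stay below \<open>\<Xi> * D\<^sup>2\<close>, and the residuals, being bounded by
  the decreases, have a bounded sum (\<open>sum_distance_decrease_le\<close>).  The error criterion bounds \<open>v k\<close>
  and \<open>\<epsilon> k\<close> by the residual, thus an iteration whose residual is at most the average satisfies the
  pointwise estimates.

  For the ergodic means, each weighted \<open>v i\<close> is \<open>\<alpha> i\<close> times the difference of two consecutive
  iterates, transformed by \<open>\<M> i\<close>.  Up to the variation of the weights and of the metrics these
  differences telescope (\<open>norm_weighted_sum_by_parts_le\<close>), which bounds the mean of the \<open>v i\<close>.  For the
  mean error one takes \<open>z\<close> to be the mean of the \<open>y i\<close> and expands the distances around \<open>xs\<close>.  The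
  squares of the distances of the iterates to \<open>xs\<close> contribute their total decrease, and the mixed
  terms are once more summed by parts.  This needs the distance from \<open>xs\<close> to the mean in all the
  metrics, which is available when consecutive metrics are comparable in both directions.

  The constants close because of a dichotomy.  Let \<open>r = 1 / ((1 + \<theta>\<^sub>l) (1 - \<sigma>))\<close>.  The squared length
  of \<open>d j\<close> is at most \<open>r\<close> times that of \<open>x j - xs\<close>.  If \<open>r < 1\<close>, then the error criterion is a
  positive definite quadratic inequality, which leaves only stationary iterations; if \<open>r \<ge> 1\<close>, then
  \<open>sqrt r \<le> r\<close>, and \<open>r\<close> can be absorbed into the stated constants.
\<close>

section \<open>Quadratic forms of self-adjoint operators\<close>

definition positive_op :: "('a::real_inner \<Rightarrow> 'a) \<Rightarrow> bool" where
  "positive_op A \<longleftrightarrow> self_adjoint A \<and> (\<forall>z. 0 \<le> z \<bullet> A z)"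

lemma self_adjoint_linear: "self_adjoint A \<Longrightarrow> linear A"
  by (simp add: self_adjoint_def)

lemma self_adjoint_inner:
  fixes A :: "'a::euclidean_space \<Rightarrow> 'a"
  assumes "self_adjoint A"
  shows "A a \<bullet> b = a \<bullet> A b"
  using assms adjoint_works[of A a b] by (simp add: self_adjoint_def)

lemma quadratic_form_add:
  fixes A :: "'a::euclidean_space \<Rightarrow> 'a"
  assumes "self_adjoint A"
  shows "(a + b) \<bullet> A (a + b) = a \<bullet> A a + 2 * (a \<bullet> A b) + b \<bullet> A b"
  using self_adjoint_inner[OF assms, of b a] self_adjoint_linear[OF assms]
  by (simp add: linear_add inner_add_left inner_add_right inner_commute)

lemma quadratic_form_diff:
  fixes A :: "'a::euclidean_space \<Rightarrow> 'a"
  assumes "self_adjoint A"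
  shows "(a - b) \<bullet> A (a - b) = a \<bullet> A a - 2 * (a \<bullet> A b) + b \<bullet> A b"
  using self_adjoint_inner[OF assms, of b a] self_adjoint_linear[OF assms]
  by (simp add: linear_diff inner_diff_left inner_diff_right inner_commute)

lemma quadratic_form_scale:
  fixes A :: "'a::euclidean_space \<Rightarrow> 'a"
  assumes "self_adjoint A"
  shows "(s *\<^sub>R a) \<bullet> A (s *\<^sub>R a) = s\<^sup>2 * (a \<bullet> A a)"
  using self_adjoint_linear[OF assms] by (simp add: linear_scale power2_eq_square)

lemma self_adjoint_diff:
  fixes A B :: "'a::euclidean_space \<Rightarrow> 'a"
  assumes "self_adjoint A" "self_adjoint B"
  shows "self_adjoint (\<lambda>z. A z - B z)"
proof -
  have "linear (\<lambda>z. A z - B z)"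
    using assms by (intro linear_compose_sub self_adjoint_linear)
  moreover have "adjoint (\<lambda>z. A z - B z) = (\<lambda>z. A z - B z)"
    by (rule adjoint_unique)
      (simp add: inner_diff_left inner_diff_right self_adjoint_inner[OF assms(1)]
        self_adjoint_inner[OF assms(2)])
  ultimately show ?thesis by (simp add: self_adjoint_def)
qed

lemma positive_op_id: "positive_op (\<lambda>z::'a::euclidean_space. z)"
proof -
  have "adjoint (\<lambda>z::'a. z) = (\<lambda>z. z)" by (rule adjoint_unique) simp
  thus ?thesis by (simp add: positive_op_def self_adjoint_def linear_ident)
qed

lemma norm_op_power2: "positive_op A \<Longrightarrow> (norm_op A z)\<^sup>2 = z \<bullet> A z"
  by (simp add: positive_op_def norm_op_def)

lemma norm_op_nonneg: "positive_op A \<Longrightarrow> 0 \<le> norm_op A z"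
  by (simp add: positive_op_def norm_op_def)

lemma norm_op_scale:
  fixes A :: "'a::euclidean_space \<Rightarrow> 'a"
  assumes "positive_op A"
  shows "norm_op A (s *\<^sub>R z) = \<bar>s\<bar> * norm_op A z"
  using assms quadratic_form_scale[of A s z]
  by (simp add: norm_op_def positive_op_def real_sqrt_mult)

text \<open>
  Polarisation bounds the bilinear form by the arithmetic mean of the two quadratic forms, and
  rescaling both vectors to unit length turns this into the geometric mean.  Taking \<open>N = G\<close> gives
  the Cauchy--Schwarz inequality, taking \<open>G\<close> to be the identity gives the spectral norm bound, and
  with \<open>N\<close> a difference of two consecutive metrics it controls the variation of the metric.
\<close>

lemma bilinear_form_le_norm_op:
  fixes N G :: "'a::euclidean_space \<Rightarrow> 'a"
  assumes N: "self_adjoint N" and G: "positive_op G" and C: "0 \<le> C"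
    and le: "\<And>z. \<bar>z \<bullet> N z\<bar> \<le> C * (z \<bullet> G z)"
  shows "\<bar>a \<bullet> N b\<bar> \<le> C * (norm_op G a * norm_op G b)"
proof -
  have Gs: "self_adjoint G" using G by (simp add: positive_op_def)
  have mean: "2 * \<bar>a \<bullet> N b\<bar> \<le> C * (a \<bullet> G a + b \<bullet> G b)" for a b
    using le[of "a + b"] le[of "a - b"]
    unfolding quadratic_form_add[OF N] quadratic_form_diff[OF N]
      quadratic_form_add[OF Gs] quadratic_form_diff[OF Gs] by (simp add: algebra_simps)
  let ?A = "norm_op G a" and ?B = "norm_op G b"
  have A0: "0 \<le> ?A" and B0: "0 \<le> ?B" using G by (simp_all add: norm_op_nonneg)
  \<comment> \<open>The normalising lengths are enlarged by \<open>\<delta>\<close> because \<open>G\<close> may be degenerate.\<close>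
  have bound: "\<bar>a \<bullet> N b\<bar> \<le> C * ((?A + \<delta>) * (?B + \<delta>))" if "\<delta> > 0" for \<delta>
  proof -
    define s t where "s = 1 / (?A + \<delta>)" and "t = 1 / (?B + \<delta>)"
    have s: "s > 0" and t: "t > 0" using A0 B0 that by (simp_all add: s_def t_def add_nonneg_pos)
    have "(s *\<^sub>R a) \<bullet> G (s *\<^sub>R a) = (s * ?A)\<^sup>2" "(t *\<^sub>R b) \<bullet> G (t *\<^sub>R b) = (t * ?B)\<^sup>2"
      by (simp_all only: quadratic_form_scale[OF Gs] power_mult_distrib norm_op_power2[OF G])
    moreover have "(s * ?A)\<^sup>2 \<le> 1" "(t * ?B)\<^sup>2 \<le> 1"
      using A0 B0 that
      by (simp_all add: s_def t_def abs_square_le_1 divide_le_eq_1 add_nonneg_pos)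
    ultimately have "C * ((s *\<^sub>R a) \<bullet> G (s *\<^sub>R a) + (t *\<^sub>R b) \<bullet> G (t *\<^sub>R b)) \<le> C * 2"
      using C by (intro mult_left_mono) auto
    hence "\<bar>(s *\<^sub>R a) \<bullet> N (t *\<^sub>R b)\<bar> \<le> C"
      using mean[of "s *\<^sub>R a" "t *\<^sub>R b"] by linarith
    hence "s * t * \<bar>a \<bullet> N b\<bar> \<le> C"
      using s t by (simp add: linear_scale[OF self_adjoint_linear[OF N]] abs_mult mult.assoc
          mult.left_commute)
    moreover have "0 < (?A + \<delta>) * (?B + \<delta>)" using A0 B0 that by (simp add: add_nonneg_pos)
    ultimately show ?thesis by (simp add: s_def t_def pos_divide_le_eq)
  qed
  have "((\<lambda>\<delta>. C * ((?A + \<delta>) * (?B + \<delta>))) \<longlongrightarrow> C * ((?A + 0) * (?B + 0))) (at_right 0)"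
    by (intro tendsto_intros)
  moreover have "eventually (\<lambda>\<delta>. \<bar>a \<bullet> N b\<bar> \<le> C * ((?A + \<delta>) * (?B + \<delta>))) (at_right 0)"
    using bound by (intro eventually_at_rightI[of 0 1]) auto
  ultimately show ?thesis using tendsto_lowerbound[of _ "C * ((?A + 0) * (?B + 0))"] by force
qed

lemma inner_le_norm_op:
  fixes A :: "'a::euclidean_space \<Rightarrow> 'a"
  assumes "positive_op A"
  shows "\<bar>a \<bullet> A b\<bar> \<le> norm_op A a * norm_op A b"
  using assms bilinear_form_le_norm_op[of A A 1] by (simp add: positive_op_def)

lemma norm_op_triangle:
  fixes A :: "'a::euclidean_space \<Rightarrow> 'a"
  assumes A: "positive_op A"
  shows "norm_op A (a + b) \<le> norm_op A a + norm_op A b"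
proof (rule power2_le_imp_le)
  have "(norm_op A (a + b))\<^sup>2 = (norm_op A a)\<^sup>2 + 2 * (a \<bullet> A b) + (norm_op A b)\<^sup>2"
    using A by (simp add: norm_op_power2 quadratic_form_add positive_op_def)
  thus "(norm_op A (a + b))\<^sup>2 \<le> (norm_op A a + norm_op A b)\<^sup>2"
    using inner_le_norm_op[OF A, of a b] by (simp add: power2_sum)
qed (use A in \<open>simp add: norm_op_nonneg\<close>)

lemma norm_op_weighted_sum_le:
  fixes A :: "'a::euclidean_space \<Rightarrow> 'a"
  assumes A: "positive_op A" and "finite S" and "\<And>i. i \<in> S \<Longrightarrow> 0 \<le> w i"
    and "\<And>i. i \<in> S \<Longrightarrow> norm_op A (z i) \<le> K"
  shows "norm_op A (\<Sum>i\<in>S. w i *\<^sub>R z i) \<le> sum w S * K"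
  using assms(2-)
proof (induction S rule: finite_induct)
  case empty
  then show ?case by (simp add: norm_op_def)
next
  case (insert j S)
  have "norm_op A (\<Sum>i\<in>insert j S. w i *\<^sub>R z i)
      \<le> norm_op A (w j *\<^sub>R z j) + norm_op A (\<Sum>i\<in>S. w i *\<^sub>R z i)"
    using insert.hyps norm_op_triangle[OF A] by simp
  also have "\<dots> \<le> w j * K + sum w S * K"
    using insert A by (intro add_mono) (auto simp: norm_op_scale intro: mult_left_mono)
  finally show ?case using insert.hyps by (simp add: distrib_right)
qed

lemma norm_le_of_quadratic_form_le:
  fixes N :: "'a::euclidean_space \<Rightarrow> 'a"
  assumes "self_adjoint N" and "0 \<le> C" and "\<And>z. \<bar>z \<bullet> N z\<bar> \<le> C * (norm z)\<^sup>2"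
  shows "norm (N z) \<le> C * norm z"
proof -
  have "\<bar>N z \<bullet> N z\<bar> \<le> C * (norm_op (\<lambda>z. z) (N z) * norm_op (\<lambda>z. z) z)"
    by (rule bilinear_form_le_norm_op) (use assms in \<open>auto simp: positive_op_id dot_square_norm\<close>)
  hence "norm (N z) * norm (N z) \<le> (C * norm z) * norm (N z)"
    by (simp add: norm_op_def norm_eq_sqrt_inner[symmetric] dot_square_norm power2_eq_square mult_ac)
  thus ?thesis
    using assms(2) by (cases "N z = 0") auto
qed

lemma norm_le_norm_op:
  fixes A :: "'a::euclidean_space \<Rightarrow> 'a"
  assumes A: "positive_op A" and "0 \<le> C" and "\<And>z. z \<bullet> A z \<le> C * (norm z)\<^sup>2"
  shows "norm (A z) \<le> sqrt C * norm_op A z"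
proof -
  have "norm_op A (A z) \<le> sqrt C * norm (A z)"
    using real_sqrt_le_mono[OF assms(3)[of "A z"]] by (simp add: norm_op_def real_sqrt_mult)
  hence "norm_op A (A z) * norm_op A z \<le> (sqrt C * norm (A z)) * norm_op A z"
    using A by (intro mult_right_mono norm_op_nonneg)
  moreover have "(norm (A z))\<^sup>2 \<le> norm_op A (A z) * norm_op A z"
    using inner_le_norm_op[OF A, of "A z" z] by (simp add: dot_square_norm)
  ultimately have "norm (A z) * norm (A z) \<le> (sqrt C * norm_op A z) * norm (A z)"
    by (simp add: power2_eq_square algebra_simps)
  thus ?thesis
    using assms by (cases "A z = 0") (auto simp: norm_op_nonneg)
qed

section \<open>The variable metrics\<close>

context vmor_hpe
begin

definition growth :: "nat \<Rightarrow> real" where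
  "growth k = (\<Prod>i<k. 1 + \<xi> i)"

definition \<Xi> :: real where
  "\<Xi> = (\<Prod>i. 1 + \<xi> i)"

lemma growth_0: "growth 0 = 1"
  by (simp add: growth_def)

lemma growth_Suc: "growth (Suc k) = (1 + \<xi> k) * growth k"
  by (simp add: growth_def)

lemma growth_ge_1: "1 \<le> growth k"
  unfolding growth_def by (rule prod_ge_1) (simp add: xi_nonneg)

lemma growth_le_Xi: "growth k \<le> \<Xi>"
proof -
  have "convergent_prod (\<lambda>i. 1 + \<xi> i)"
  proof (rule summable_imp_convergent_prod_real)
    show "summable (\<lambda>i. \<bar>\<xi> i\<bar>)" using xi_summable xi_nonneg by simp
    show "\<xi> i \<noteq> -1" for i using xi_nonneg[of i] by linarith
  qed
  thus ?thesis
    unfolding growth_def \<Xi>_def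
    by (intro prod_le_prodinf[OF convergent_prod_has_prod]) (simp_all add: xi_nonneg)
qed

lemma Xi_ge_1: "1 \<le> \<Xi>"
  using growth_ge_1 growth_le_Xi order_trans by blast

lemma M_lower: "\<omega>\<^sub>l * (norm z)\<^sup>2 \<le> z \<bullet> \<M> k z"
  using M_0_lower M_Suc_lower
  by (cases k) (simp_all add: loewner_le_def inner_diff_right dot_square_norm)

lemma positive_M: "positive_op (\<M> k)"
  unfolding positive_op_def
  using M_self_adjoint M_lower[of _ k] omega_l_pos
  by (metis mult_nonneg_nonneg less_imp_le order_trans zero_le_power2)

lemma linear_M: "linear (\<M> k)"
  using M_self_adjoint by (rule self_adjoint_linear)

lemma M_inv: "\<M> k (inv (\<M> k) w) = w"
proof -
  have "inj (\<M> k)"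
  proof (subst linear_injective_0[OF linear_M], intro allI impI)
    fix z assume "\<M> k z = 0"
    thus "z = 0" using M_lower[of z k] omega_l_pos by (simp add: mult_le_0_iff)
  qed
  hence "surj (\<M> k)" using linear_M by (intro linear_injective_imp_surjective) simp_all
  thus ?thesis by (rule surj_f_inv_f)
qed

lemma M_Suc_le: "z \<bullet> \<M> (Suc k) z \<le> (1 + \<xi> k) * (z \<bullet> \<M> k z)"
  using M_Suc_upper[of k] by (simp add: loewner_le_def inner_diff_right)

lemma M_le_growth:
  assumes "i \<le> j"
  shows "growth i * (z \<bullet> \<M> j z) \<le> growth j * (z \<bullet> \<M> i z)"
  using assms
proof (induction j rule: dec_induct)
  case (step j)
  have "growth i * (z \<bullet> \<M> (Suc j) z) \<le> growth i * ((1 + \<xi> j) * (z \<bullet> \<M> j z))"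
    using M_Suc_le growth_ge_1[of i] by (intro mult_left_mono) auto
  also have "\<dots> \<le> (1 + \<xi> j) * (growth j * (z \<bullet> \<M> i z))"
    using mult_left_mono[OF step.IH, of "1 + \<xi> j"] xi_nonneg[of j] by (simp add: algebra_simps)
  finally show ?case by (simp add: growth_Suc algebra_simps)
qed simp

lemma M_upper: "z \<bullet> \<M> k z \<le> \<Xi> * \<omega>\<^sub>u * (norm z)\<^sup>2"
proof -
  have "z \<bullet> \<M> k z \<le> growth k * (z \<bullet> \<M> 0 z)"
    using M_le_growth[of 0 k z] by (simp add: growth_0)
  also have "\<dots> \<le> \<Xi> * (\<omega>\<^sub>u * (norm z)\<^sup>2)"
  proof (rule mult_mono)
    show "z \<bullet> \<M> 0 z \<le> \<omega>\<^sub>u * (norm z)\<^sup>2"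
      using M_0_upper by (simp add: loewner_le_def inner_diff_right dot_square_norm)
    show "0 \<le> z \<bullet> \<M> 0 z" using positive_M by (simp add: positive_op_def)
  qed (use growth_le_Xi Xi_ge_1 in auto)
  finally show ?thesis by simp
qed

lemma norm_le_norm_M: "norm z \<le> norm_op (\<M> k) z / sqrt \<omega>\<^sub>l"
proof -
  have "sqrt (\<omega>\<^sub>l * (norm z)\<^sup>2) \<le> sqrt (z \<bullet> \<M> k z)"
    using M_lower by (rule real_sqrt_le_mono)
  thus ?thesis using omega_l_pos by (simp add: norm_op_def real_sqrt_mult field_simps)
qed

lemma norm_M_le: "norm (\<M> k z) \<le> \<Xi> * \<omega>\<^sub>u * norm z"
proof (rule norm_le_of_quadratic_form_le[OF M_self_adjoint])
  show "0 \<le> \<Xi> * \<omega>\<^sub>u" using Xi_ge_1 omega_u_pos by simp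
  show "\<bar>z \<bullet> \<M> k z\<bar> \<le> \<Xi> * \<omega>\<^sub>u * (norm z)\<^sup>2" for z
    using M_upper[of z k] positive_M[of k] by (simp add: positive_op_def)
qed

section \<open>Energy decrease of a single iteration\<close>

definition u :: "nat \<Rightarrow> 'a" where
  "u k = c k *\<^sub>R inv (\<M> k) (v k)"

definition d :: "nat \<Rightarrow> 'a" where
  "d k = y k - x k"

lemma M_u: "\<M> k (u k) = c k *\<^sub>R v k"
  by (simp add: u_def linear_scale[OF linear_M] M_inv)

lemma x_Suc: "x (Suc k) = x k - (1 + \<theta> k) *\<^sub>R u k"
  by (simp add: step u_def)

lemma c_pos: "0 < c k"
  using c_ge[of k] c_l_pos by linarith

lemma theta_pos: "0 < 1 + \<theta> k"
  using theta_ge[of k] theta_l by linarith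

lemma error_criterion_expanded:
  "(1 + \<theta> k) * (u k \<bullet> \<M> k (u k)) + 2 * (u k \<bullet> \<M> k (d k))
     + (1 - \<sigma>) * (d k \<bullet> \<M> k (d k)) + 2 * c k * \<epsilon> k \<le> 0"
  using error_criterion[of k]
  unfolding norm_op_power2[OF positive_M] quadratic_form_add[OF M_self_adjoint]
    u_def[symmetric] d_def[symmetric]
  by (simp add: algebra_simps)

text \<open>
  The step to \<open>x (Suc k)\<close> is a multiple of \<open>u k\<close>, whose image under \<open>\<M> k\<close> is \<open>c k *\<^sub>R v k\<close>.  Expanding
  the square of the distance to \<open>z\<close> therefore produces the pairing of \<open>v k\<close> with \<open>y k - z\<close>, and the
  remaining terms are exactly those that the error criterion controls.
\<close>

lemma energy_decrease:
  "2 * ((1 + \<theta> k) * c k) * (\<epsilon> k + v k \<bullet> (y k - z))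
     \<le> (x k - z) \<bullet> \<M> k (x k - z) - (x (Suc k) - z) \<bullet> \<M> k (x (Suc k) - z)
       - (1 + \<theta> k) * (1 - \<sigma>) * (d k \<bullet> \<M> k (d k))"
proof -
  let ?h = "1 + \<theta> k" and ?e = "x k - z"
  have rel: "x (Suc k) - z = ?e - ?h *\<^sub>R u k" by (simp add: x_Suc)
  have expand: "(x (Suc k) - z) \<bullet> \<M> k (x (Suc k) - z)
      = ?e \<bullet> \<M> k ?e - 2 * (?h * (?e \<bullet> \<M> k (u k))) + ?h\<^sup>2 * (u k \<bullet> \<M> k (u k))"
    unfolding rel
    using quadratic_form_diff[OF M_self_adjoint, of ?e "?h *\<^sub>R u k"]
    by (simp add: quadratic_form_scale[OF M_self_adjoint] linear_scale[OF linear_M]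
        power2_eq_square)
  have "c k * (v k \<bullet> (y k - z)) = \<M> k (u k) \<bullet> ?e + \<M> k (u k) \<bullet> d k"
    by (simp add: M_u d_def inner_diff_right algebra_simps)
  hence pairing: "c k * (v k \<bullet> (y k - z)) = ?e \<bullet> \<M> k (u k) + u k \<bullet> \<M> k (d k)"
    using self_adjoint_inner[OF M_self_adjoint, of k "u k" "d k"]
    by (simp add: inner_commute[of _ ?e])
  have "?h * ((1 + \<theta> k) * (u k \<bullet> \<M> k (u k)) + 2 * (u k \<bullet> \<M> k (d k))
     + (1 - \<sigma>) * (d k \<bullet> \<M> k (d k)) + 2 * c k * \<epsilon> k) \<le> 0"
    using error_criterion_expanded[of k] theta_pos[of k] by (simp add: mult_le_0_iff)
  moreover have "2 * (?h * c k) * (\<epsilon> k + v k \<bullet> (y k - z))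
      = ?h * (2 * c k * \<epsilon> k) + 2 * ?h * (c k * (v k \<bullet> (y k - z)))"
    by (simp add: algebra_simps)
  ultimately show ?thesis
    unfolding expand pairing by (simp add: algebra_simps power2_eq_square)
qed

text \<open>
  By Cauchy--Schwarz the error criterion becomes a quadratic inequality in the lengths of \<open>u k\<close> and
  \<open>d k\<close>.  It bounds \<open>u k\<close> and \<open>\<epsilon> k\<close> by \<open>d k\<close>, and if its quadratic part is positive definite, then
  it leaves only the zero solution.
\<close>

lemma error_criterion_scalar:
  "(1 + \<theta> k) * (norm_op (\<M> k) (u k))\<^sup>2 - 2 * (norm_op (\<M> k) (u k) * norm_op (\<M> k) (d k))
     + (1 - \<sigma>) * (norm_op (\<M> k) (d k))\<^sup>2 + 2 * c k * \<epsilon> k \<le> 0"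
  using error_criterion_expanded[of k] inner_le_norm_op[OF positive_M, of "u k" k "d k"]
  by (simp add: norm_op_power2[OF positive_M])

lemma norm_u_le: "(1 + \<theta> k) * norm_op (\<M> k) (u k) \<le> 2 * norm_op (\<M> k) (d k)"
proof -
  let ?U = "norm_op (\<M> k) (u k)" and ?D = "norm_op (\<M> k) (d k)"
  have "0 \<le> (1 - \<sigma>) * ?D\<^sup>2" "0 \<le> c k * \<epsilon> k"
    using sigma eps_nonneg c_pos[of k] by (simp_all add: less_imp_le)
  hence "((1 + \<theta> k) * ?U) * ?U \<le> (2 * ?D) * ?U"
    using error_criterion_scalar[of k] by (simp add: power2_eq_square algebra_simps)
  thus ?thesis
    using norm_op_nonneg[OF positive_M, of k "u k"] norm_op_nonneg[OF positive_M, of k "d k"]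
    by (cases "?U = 0") auto
qed

text \<open>Multiplication by \<open>1 + \<theta> k\<close> and completion of the square in \<open>u k\<close>.\<close>

lemma scaled_error_criterion:
  "((1 + \<theta> k) * norm_op (\<M> k) (u k) - norm_op (\<M> k) (d k))\<^sup>2
     + ((1 + \<theta> k) * (1 - \<sigma>) - 1) * (norm_op (\<M> k) (d k))\<^sup>2
     + 2 * (1 + \<theta> k) * c k * \<epsilon> k \<le> 0"
proof -
  let ?U = "norm_op (\<M> k) (u k)" and ?D = "norm_op (\<M> k) (d k)"
  have "(1 + \<theta> k) * ((1 + \<theta> k) * ?U\<^sup>2 - 2 * (?U * ?D) + (1 - \<sigma>) * ?D\<^sup>2 + 2 * c k * \<epsilon> k) \<le> 0"
    using error_criterion_scalar[of k] theta_pos[of k] by (simp add: mult_le_0_iff)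
  thus ?thesis by (simp add: power2_eq_square algebra_simps)
qed

lemma eps_le: "2 * (1 + \<theta> k) * c k * \<epsilon> k \<le> (norm_op (\<M> k) (d k))\<^sup>2"
proof -
  have "0 \<le> (1 + \<theta> k) * (1 - \<sigma>) * (norm_op (\<M> k) (d k))\<^sup>2"
    using theta_pos[of k] sigma by simp
  moreover have "0 \<le> ((1 + \<theta> k) * norm_op (\<M> k) (u k) - norm_op (\<M> k) (d k))\<^sup>2" by simp
  ultimately show ?thesis
    using scaled_error_criterion[of k] unfolding left_diff_distrib[of _ 1] by linarith
qed

lemma stationary_if_overrelaxed:
  assumes "1 < (1 + \<theta> k) * (1 - \<sigma>)"
  shows "v k = 0" and "\<epsilon> k = 0"
proof -
  let ?U = "norm_op (\<M> k) (u k)" and ?D = "norm_op (\<M> k) (d k)"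
  have h: "0 < 1 + \<theta> k" by (rule theta_pos)
  have sq: "0 \<le> ((1 + \<theta> k) * ?U - ?D)\<^sup>2" and D: "0 \<le> ((1 + \<theta> k) * (1 - \<sigma>) - 1) * ?D\<^sup>2"
    and e: "0 \<le> 2 * (1 + \<theta> k) * c k * \<epsilon> k"
    using assms h c_pos[of k] eps_nonneg[of k] by (simp_all add: less_imp_le)
  have "2 * (1 + \<theta> k) * c k * \<epsilon> k = 0"
    using scaled_error_criterion[of k] sq D e by linarith
  thus "\<epsilon> k = 0" using h c_pos[of k] by simp
  have "((1 + \<theta> k) * (1 - \<sigma>) - 1) * ?D\<^sup>2 = 0"
    using scaled_error_criterion[of k] sq D e by linarith
  hence "?D = 0" using assms by auto
  hence "?U = 0"
    using norm_u_le[of k] h norm_op_nonneg[OF positive_M, of k "u k"] by (simp add: mult_le_0_iff)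
  hence "u k = 0"
    using norm_le_norm_M[of "u k" k] by simp
  thus "v k = 0"
    using M_u[of k] linear_0[OF linear_M] c_pos[of k] by simp
qed

end

section \<open>Distance to a zero of the operator\<close>

locale vmor_hpe_zero = vmor_hpe +
  fixes xs :: 'a
  assumes zero: "0 \<in> T xs"
begin

definition D :: real where
  "D = norm_op (\<M> 0) (x 0 - xs)"

lemma D_nonneg: "0 \<le> D"
  using positive_M by (simp add: D_def norm_op_nonneg)

lemma distance_decrease:
  "(1 + \<theta> k) * (1 - \<sigma>) * (d k \<bullet> \<M> k (d k))
     \<le> (x k - xs) \<bullet> \<M> k (x k - xs) - (x (Suc k) - xs) \<bullet> \<M> k (x (Suc k) - xs)"
proof -
  have "- \<epsilon> k \<le> (0 - v k) \<bullet> (xs - y k)"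
    using inclusion[of k] zero unfolding gph_def enlargement_def by blast
  hence "0 \<le> \<epsilon> k + v k \<bullet> (y k - xs)"
    by (simp add: inner_diff_right inner_diff_left)
  hence "0 \<le> 2 * ((1 + \<theta> k) * c k) * (\<epsilon> k + v k \<bullet> (y k - xs))"
    using theta_pos[of k] c_pos[of k] by simp
  thus ?thesis using energy_decrease[of k xs] by linarith
qed

lemma distance_antimono:
  "(x (Suc k) - xs) \<bullet> \<M> k (x (Suc k) - xs) \<le> (x k - xs) \<bullet> \<M> k (x k - xs)"
proof -
  have "0 \<le> (1 + \<theta> k) * (1 - \<sigma>) * (d k \<bullet> \<M> k (d k))"
    using theta_pos[of k] sigma positive_M[of k] by (simp add: positive_op_def)
  thus ?thesis using distance_decrease[of k] by linarith
qed

lemma distance_le_growth: "(x k - xs) \<bullet> \<M> k (x k - xs) \<le> growth k * D\<^sup>2"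
proof (induction k)
  case 0
  show ?case using positive_M by (simp add: growth_0 D_def norm_op_power2)
next
  case (Suc k)
  have "(x (Suc k) - xs) \<bullet> \<M> (Suc k) (x (Suc k) - xs)
      \<le> (1 + \<xi> k) * ((x (Suc k) - xs) \<bullet> \<M> k (x (Suc k) - xs))"
    by (rule M_Suc_le)
  also have "\<dots> \<le> (1 + \<xi> k) * (growth k * D\<^sup>2)"
    using distance_antimono[of k] Suc.IH xi_nonneg[of k] by (intro mult_left_mono) auto
  finally show ?case by (simp add: growth_Suc)
qed

lemma distance_Suc_le_growth: "(x (Suc k) - xs) \<bullet> \<M> k (x (Suc k) - xs) \<le> growth k * D\<^sup>2"
  using distance_antimono distance_le_growth by (rule order_trans)

lemma residual_le_growth:
  "(1 + \<theta>\<^sub>l) * (1 - \<sigma>) * (d k \<bullet> \<M> k (d k)) \<le> growth k * D\<^sup>2"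
proof -
  have d: "0 \<le> d k \<bullet> \<M> k (d k)" using positive_M by (simp add: positive_op_def)
  have "(1 + \<theta>\<^sub>l) * (1 - \<sigma>) * (d k \<bullet> \<M> k (d k)) \<le> (1 + \<theta> k) * (1 - \<sigma>) * (d k \<bullet> \<M> k (d k))"
    using theta_ge[of k] sigma d by (intro mult_right_mono) auto
  moreover have "0 \<le> (x (Suc k) - xs) \<bullet> \<M> k (x (Suc k) - xs)"
    using positive_M by (simp add: positive_op_def)
  ultimately show ?thesis using distance_decrease[of k] distance_le_growth[of k] by linarith
qed

lemma norm_x_le: "norm (x k) \<le> norm xs + sqrt (\<Xi> / \<omega>\<^sub>l) * D"
proof -
  have "norm_op (\<M> k) (x k - xs) \<le> sqrt \<Xi> * D"
  proof -
    have "(x k - xs) \<bullet> \<M> k (x k - xs) \<le> \<Xi> * D\<^sup>2"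
      using distance_le_growth[of k] growth_le_Xi[of k]
      by (meson mult_right_mono order_trans zero_le_power2)
    hence "norm_op (\<M> k) (x k - xs) \<le> sqrt (\<Xi> * D\<^sup>2)"
      by (simp add: norm_op_def)
    thus ?thesis using D_nonneg by (simp add: real_sqrt_mult)
  qed
  hence "norm_op (\<M> k) (x k - xs) / sqrt \<omega>\<^sub>l \<le> sqrt (\<Xi> / \<omega>\<^sub>l) * D"
    using omega_l_pos by (simp add: real_sqrt_divide divide_right_mono)
  hence "norm (x k - xs) \<le> sqrt (\<Xi> / \<omega>\<^sub>l) * D"
    using norm_le_norm_M[of "x k - xs" k] by linarith
  thus ?thesis using norm_triangle_ineq[of xs "x k - xs"] by simp
qed

text \<open>
  Within an iteration the distance is measured in one metric and can only drop; it can grow only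
  when the metric is exchanged, its square by at most \<open>\<xi> i\<close> times the old value.
\<close>

lemma sum_distance_decrease_le:
  "(\<Sum>i=1..Suc n. (x i - xs) \<bullet> \<M> i (x i - xs) - (x (Suc i) - xs) \<bullet> \<M> i (x (Suc i) - xs))
     \<le> (1 + (\<Sum>i=1..Suc n. \<xi> i)) * (\<Xi> * D\<^sup>2)"
proof -
  let ?a = "\<lambda>i. (x i - xs) \<bullet> \<M> i (x i - xs)"
  let ?b = "\<lambda>i. (x (Suc i) - xs) \<bullet> \<M> i (x (Suc i) - xs)"
  have Xi: "growth i * D\<^sup>2 \<le> \<Xi> * D\<^sup>2" for i
    using growth_le_Xi by (simp add: mult_right_mono)
  have "(\<Sum>i=1..Suc n. ?a i - ?b i) \<le> (1 + (\<Sum>i=1..n. \<xi> i)) * (\<Xi> * D\<^sup>2) - ?b (Suc n)"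
  proof (induction n)
    case 0
    show ?case using distance_le_growth[of 1] Xi[of 1] by simp
  next
    case (Suc n)
    have "?a (Suc (Suc n)) \<le> (1 + \<xi> (Suc n)) * ?b (Suc n)"
      by (rule M_Suc_le)
    moreover have "\<xi> (Suc n) * ?b (Suc n) \<le> \<xi> (Suc n) * (\<Xi> * D\<^sup>2)"
      using distance_Suc_le_growth[of "Suc n"] Xi[of "Suc n"] xi_nonneg
      by (intro mult_left_mono) auto
    ultimately show ?case using Suc.IH by (simp add: algebra_simps)
  qed
  moreover have "0 \<le> ?b (Suc n)" using positive_M by (simp add: positive_op_def)
  moreover have "0 \<le> \<xi> (Suc n) * (\<Xi> * D\<^sup>2)" using xi_nonneg[of "Suc n"] Xi_ge_1 by simp
  ultimately show ?thesis by (simp add: algebra_simps)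
qed

text \<open>
  The smallest residual does not exceed the average residual, and the sum of the residuals is at
  most the total decrease of the distance.
\<close>

lemma best_iterate:
  assumes "1 \<le> k"
  obtains i where "i \<in> {1..k}"
    "(1 + \<theta> i) * (1 - \<sigma>) * (norm_op (\<M> i) (d i))\<^sup>2 \<le> (1 + (\<Sum>i=1..k. \<xi> i)) * \<Xi> * D\<^sup>2 / real k"
proof -
  let ?g = "\<lambda>i. (1 + \<theta> i) * (1 - \<sigma>) * (norm_op (\<M> i) (d i))\<^sup>2"
  let ?C = "(1 + (\<Sum>i=1..k. \<xi> i)) * \<Xi> * D\<^sup>2"
  obtain n where n: "k = Suc n" using assms by (cases k) auto
  have "(\<Sum>i=1..k. ?g i) \<le> (\<Sum>i=1..k. (x i - xs) \<bullet> \<M> i (x i - xs)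
      - (x (Suc i) - xs) \<bullet> \<M> i (x (Suc i) - xs))"
    using distance_decrease by (intro sum_mono) (simp add: norm_op_power2[OF positive_M])
  hence sum: "(\<Sum>i=1..k. ?g i) \<le> ?C"
    using sum_distance_decrease_le[of n] unfolding n by (simp add: mult.assoc)
  have "\<exists>i\<in>{1..k}. ?g i \<le> ?C / real k"
  proof (rule ccontr)
    assume "\<not> ?thesis"
    hence "(\<Sum>i=1..k. ?C / real k) < (\<Sum>i=1..k. ?g i)"
      using assms by (intro sum_strict_mono) (auto simp: not_le)
    thus False using sum assms by simp
  qed
  thus ?thesis using that by blast
qed

lemma pointwise_complexity:
  assumes "1 \<le> k"
  shows "\<exists>i\<in>{1..k}. v i \<in> enlargement T (\<epsilon> i) (y i) \<and> \<epsilon> i \<ge> 0 \<and>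
    norm (v i) \<le> sqrt (4 * (1 + (\<Sum>i=1..k. \<xi> i)) * \<Xi>\<^sup>2 * \<omega>\<^sub>u
                        / (real k * (1 - \<sigma>) * (1 + \<theta>\<^sub>l) ^ 3 * c\<^sub>l\<^sup>2)) * D \<and>
    \<epsilon> i \<le> (1 + (\<Sum>i=1..k. \<xi> i)) * \<Xi> / (real k * (1 - \<sigma>) * (1 + \<theta>\<^sub>l)\<^sup>2 * c\<^sub>l) * D\<^sup>2"
proof -
  let ?S = "1 + (\<Sum>i=1..k. \<xi> i)"
  obtain i where i: "i \<in> {1..k}"
    and best: "(1 + \<theta> i) * (1 - \<sigma>) * (norm_op (\<M> i) (d i))\<^sup>2 \<le> ?S * \<Xi> * D\<^sup>2 / real k"
    using assms by (rule best_iterate)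
  let ?h = "1 + \<theta> i" and ?U = "norm_op (\<M> i) (u i)" and ?d = "norm_op (\<M> i) (d i)"
  let ?h' = "1 + \<theta>\<^sub>l"
  define G where "G = ?S * \<Xi> * D\<^sup>2 / (real k * (1 - \<sigma>))"
  have s: "0 < 1 - \<sigma>" and k: "0 < real k" and h: "0 < ?h" and h': "0 < ?h'" "?h' \<le> ?h"
    using sigma assms theta_pos theta_l theta_ge by simp_all
  have G0: "0 \<le> G"
    using s k Xi_ge_1 xi_nonneg by (simp add: G_def sum_nonneg add_nonneg_nonneg)
  have dG: "?d\<^sup>2 \<le> G / ?h"
  proof -
    have "?d\<^sup>2 \<le> ?S * \<Xi> * D\<^sup>2 / real k / (?h * (1 - \<sigma>))"
      using best s h by (subst pos_le_divide_eq) (simp_all add: mult.commute)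
    thus ?thesis by (simp add: G_def mult_ac)
  qed
  have hc: "?h' ^ m * c\<^sub>l ^ l \<le> ?h ^ m * c i ^ l" for m l
    using h' c_ge[of i] c_l_pos by (intro mult_mono power_mono) auto
  have "\<epsilon> i \<le> ?d\<^sup>2 / (2 * ?h * c i)"
    using eps_le[of i] h c_pos[of i] by (subst pos_le_divide_eq) (simp_all add: mult_ac)
  also have "\<dots> \<le> ?d\<^sup>2 / (?h * c i)"
    using h c_pos[of i] by (intro divide_left_mono) auto
  also have "\<dots> \<le> (G / ?h) / (?h * c i)"
    using dG h c_pos[of i] by (intro divide_right_mono) auto
  also have "\<dots> = G / (?h ^ 2 * c i ^ 1)"
    by (simp add: power2_eq_square)
  also have "\<dots> \<le> G / (?h' ^ 2 * c\<^sub>l ^ 1)"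
    using G0 hc[of 2 1] h h' c_pos[of i] c_l_pos by (intro divide_left_mono) auto
  also have "\<dots> = ?S * \<Xi> / (real k * (1 - \<sigma>) * ?h'\<^sup>2 * c\<^sub>l) * D\<^sup>2"
    by (simp add: G_def)
  finally have eps: "\<epsilon> i \<le> \<dots>" .

  have "c i * norm (v i) \<le> sqrt (\<Xi> * \<omega>\<^sub>u) * ?U"
    using norm_le_norm_op[OF positive_M, of "\<Xi> * \<omega>\<^sub>u" i "u i"] M_upper Xi_ge_1 omega_u_pos
      c_pos[of i] by (simp add: M_u)
  moreover have "?U \<le> 2 * ?d / ?h"
    using norm_u_le[of i] h by (simp add: field_simps)
  ultimately have "c i * norm (v i) \<le> sqrt (\<Xi> * \<omega>\<^sub>u) * (2 * ?d / ?h)"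
    using Xi_ge_1 omega_u_pos by (meson mult_left_mono order_trans real_sqrt_ge_zero
        mult_nonneg_nonneg less_imp_le zero_le_one)
  hence "(c i * norm (v i))\<^sup>2 \<le> (sqrt (\<Xi> * \<omega>\<^sub>u) * (2 * ?d / ?h))\<^sup>2"
    using c_pos[of i] by (intro power_mono) auto
  hence "(norm (v i))\<^sup>2 \<le> (4 * \<Xi> * \<omega>\<^sub>u) * ?d\<^sup>2 / (?h ^ 2 * c i ^ 2)"
    using Xi_ge_1 omega_u_pos c_pos[of i] h by (simp add: power_mult_distrib power_divide field_simps)
  also have "\<dots> \<le> (4 * \<Xi> * \<omega>\<^sub>u) * (G / ?h) / (?h ^ 2 * c i ^ 2)"
    using dG Xi_ge_1 omega_u_pos by (intro divide_right_mono mult_left_mono) auto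
  also have "\<dots> = (4 * \<Xi> * \<omega>\<^sub>u * G) / (?h ^ 3 * c i ^ 2)"
    by (simp add: power2_eq_square power3_eq_cube)
  also have "\<dots> \<le> (4 * \<Xi> * \<omega>\<^sub>u * G) / (?h' ^ 3 * c\<^sub>l ^ 2)"
    using G0 hc[of 3 2] h h' c_pos[of i] c_l_pos Xi_ge_1 omega_u_pos by (intro divide_left_mono) auto
  also have "\<dots> = (4 * ?S * \<Xi>\<^sup>2 * \<omega>\<^sub>u / (real k * (1 - \<sigma>) * ?h' ^ 3 * c\<^sub>l\<^sup>2)) * D\<^sup>2"
    by (simp add: G_def power2_eq_square mult_ac)
  finally have "norm (v i) \<le> sqrt (\<dots>)" by (rule real_le_rsqrt)
  hence "norm (v i) \<le> sqrt (4 * ?S * \<Xi>\<^sup>2 * \<omega>\<^sub>u / (real k * (1 - \<sigma>) * ?h' ^ 3 * c\<^sub>l\<^sup>2)) * D"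
    using D_nonneg by (simp only: real_sqrt_mult real_sqrt_unique real_sqrt_abs abs_of_nonneg)
  moreover have "v i \<in> enlargement T (\<epsilon> i) (y i)"
    using inclusion[of i] by (simp add: gph_def)
  ultimately show ?thesis using i eps eps_nonneg by blast
qed

end

section \<open>Weighted sums\<close>

lemma sum_weighted_deviation:
  fixes f :: "nat \<Rightarrow> 'b::real_vector"
  assumes "sum w S \<noteq> 0"
  shows "(\<Sum>i\<in>S. w i *\<^sub>R (f i - (\<Sum>i\<in>S. w i *\<^sub>R f i) /\<^sub>R sum w S)) = 0"
proof -
  have "(\<Sum>i\<in>S. w i *\<^sub>R (f i - m)) = (\<Sum>i\<in>S. w i *\<^sub>R f i) - sum w S *\<^sub>R m" for m
    by (simp add: scaleR_diff_right sum_subtractf scaleR_left.sum)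
  thus ?thesis using assms by simp
qed

text \<open>
  Summation by parts: the term \<open>\<alpha> (Suc i) *\<^sub>R g (Suc i)\<close> is matched with \<open>\<alpha> i *\<^sub>R h i\<close>, so that a
  telescoping sum is disturbed only by the gaps \<open>g (Suc i) - h i\<close> and by the variation of the
  weights.
\<close>

lemma norm_weighted_sum_by_parts_le:
  fixes g h :: "nat \<Rightarrow> 'b::real_normed_vector" and \<alpha> \<xi> :: "nat \<Rightarrow> real"
  assumes \<alpha>: "\<And>i. i \<ge> 1 \<Longrightarrow> 0 \<le> \<alpha> i"
    and g: "norm (g 1) \<le> K" and h: "\<And>i. norm (h i) \<le> K"
    and gap: "\<And>i. norm (g (Suc i) - h i) \<le> \<xi> i * K"
  shows "norm (\<Sum>i=1..Suc n. \<alpha> i *\<^sub>R (g i - h i))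
    \<le> (\<alpha> 1 + \<alpha> (Suc n) + (\<Sum>i=1..n. \<alpha> (Suc i) * \<xi> i + \<bar>\<alpha> (Suc i) - \<alpha> i\<bar>)) * K"
proof -
  let ?t = "\<lambda>i. \<alpha> (Suc i) *\<^sub>R (g (Suc i) - h i) + (\<alpha> (Suc i) - \<alpha> i) *\<^sub>R h i"
  have "(\<Sum>i=1..Suc n. \<alpha> i *\<^sub>R (g i - h i))
      = \<alpha> 1 *\<^sub>R g 1 - \<alpha> (Suc n) *\<^sub>R h (Suc n) + (\<Sum>i=1..n. ?t i)"
    by (induction n) (simp_all add: algebra_simps)
  also have "norm \<dots> \<le> norm (\<alpha> 1 *\<^sub>R g 1) + norm (\<alpha> (Suc n) *\<^sub>R h (Suc n)) + norm (\<Sum>i=1..n. ?t i)"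
    by (meson add_right_mono norm_triangle_ineq norm_triangle_ineq4 order_trans)
  also have "\<dots> \<le> \<alpha> 1 * K + \<alpha> (Suc n) * K
      + (\<Sum>i=1..n. \<alpha> (Suc i) * (\<xi> i * K) + \<bar>\<alpha> (Suc i) - \<alpha> i\<bar> * K)"
  proof (intro add_mono sum_norm_le)
    show "norm (\<alpha> 1 *\<^sub>R g 1) \<le> \<alpha> 1 * K" using \<alpha>[of 1] g by (simp add: mult_left_mono)
    show "norm (\<alpha> (Suc n) *\<^sub>R h (Suc n)) \<le> \<alpha> (Suc n) * K"
      using \<alpha>[of "Suc n"] h by (simp add: mult_left_mono)
    fix i
    have "norm (?t i) \<le> norm (\<alpha> (Suc i) *\<^sub>R (g (Suc i) - h i)) + norm ((\<alpha> (Suc i) - \<alpha> i) *\<^sub>R h i)"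
      by (rule norm_triangle_ineq)
    also have "\<dots> \<le> \<alpha> (Suc i) * (\<xi> i * K) + \<bar>\<alpha> (Suc i) - \<alpha> i\<bar> * K"
      using \<alpha>[of "Suc i"] gap[of i] h[of i] by (simp add: add_mono mult_left_mono)
    finally show "norm (?t i) \<le> \<dots>" .
  qed
  also have "\<dots> = (\<alpha> 1 + \<alpha> (Suc n)
      + (\<Sum>i=1..n. \<alpha> (Suc i) * \<xi> i + \<bar>\<alpha> (Suc i) - \<alpha> i\<bar>)) * K"
    by (simp add: distrib_right sum_distrib_right mult.assoc)
  finally show ?thesis .
qed

section \<open>Ergodic means\<close>

text \<open>
  Otherwise \<open>v\<close> would be strictly monotonically related to every point of the graph, hence
  \<open>(y, v)\<close> would belong to the graph by maximality, which contradicts the strict inequality for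
  that very point.
\<close>

lemma enlargement_nonneg:
  assumes T: "maximal_monotone T" and v: "v \<in> enlargement T \<epsilon> y"
  shows "0 \<le> \<epsilon>"
proof (rule ccontr)
  assume neg: "\<not> 0 \<le> \<epsilon>"
  have rel: "- \<epsilon> \<le> (w - v) \<bullet> (z - y)" if "w \<in> T z" for z w
    using v that by (auto simp: enlargement_def)
  define S where "S = T(y := insert v (T y))"
  have gS: "gph S = insert (y, v) (gph T)"
    by (auto simp: S_def gph_def split: if_splits)
  have mono: "0 \<le> (b - b') \<bullet> (a - a')" if "(a, b) \<in> gph T" "(a', b') \<in> gph T" for a b a' b'
    using T that unfolding maximal_monotone_def monotone_operator_def by blast
  have rel': "0 \<le> (b - v) \<bullet> (a - y)" "0 \<le> (v - b) \<bullet> (y - a)" if "(a, b) \<in> gph T" for a b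
    using rel[of b a] neg that by (auto simp: gph_def inner_diff_left inner_diff_right)
  have "monotone_operator S"
    unfolding monotone_operator_def gS using mono rel' by auto
  hence "gph S = gph T"
    using T gS unfolding maximal_monotone_def by (metis subset_insertI)
  hence "v \<in> T y" using gS by (auto simp: gph_def)
  thus False using rel[of v y] neg by simp
qed

locale vmor_hpe_means = vmor_hpe_zero +
  fixes \<alpha> :: "nat \<Rightarrow> real" and k :: nat
  assumes alpha_nonneg: "\<And>i. 1 \<le> i \<Longrightarrow> 0 \<le> \<alpha> i"
    and alpha_sum_pos: "0 < (\<Sum>i=1..k. \<alpha> i)"
begin

definition w :: "nat \<Rightarrow> real" where
  "w i = (1 + \<theta> i) * c i * \<alpha> i"

definition ymean :: 'a where
  "ymean = (\<Sum>i=1..k. w i *\<^sub>R y i) /\<^sub>R sum w {1..k}"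

definition vmean :: 'a where
  "vmean = (\<Sum>i=1..k. w i *\<^sub>R v i) /\<^sub>R sum w {1..k}"

definition emean :: real where
  "emean = (\<Sum>i=1..k. w i * (\<epsilon> i + (y i - ymean) \<bullet> (v i - vmean))) / sum w {1..k}"

lemma w_nonneg: "1 \<le> i \<Longrightarrow> 0 \<le> w i"
  using theta_pos[of i] c_pos[of i] alpha_nonneg[of i] by (simp add: w_def)

lemma weight_sum_ge: "c\<^sub>l * (1 + \<theta>\<^sub>l) * (\<Sum>i=1..k. \<alpha> i) \<le> sum w {1..k}"
proof -
  have "(1 + \<theta>\<^sub>l) * c\<^sub>l * \<alpha> i \<le> w i" if "i \<in> {1..k}" for i
    using that theta_ge[of i] theta_l c_ge[of i] c_l_pos alpha_nonneg[of i]
    unfolding w_def by (intro mult_right_mono mult_mono) auto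
  hence "(\<Sum>i=1..k. (1 + \<theta>\<^sub>l) * c\<^sub>l * \<alpha> i) \<le> sum w {1..k}"
    by (rule sum_mono)
  thus ?thesis by (simp add: sum_distrib_left mult_ac)
qed

lemma weight_lower_pos: "0 < c\<^sub>l * (1 + \<theta>\<^sub>l) * (\<Sum>i=1..k. \<alpha> i)"
  using c_l_pos theta_l alpha_sum_pos by simp

lemma weight_sum_pos: "0 < sum w {1..k}"
  using weight_sum_ge weight_lower_pos by linarith

lemma y_deviation: "(\<Sum>i=1..k. w i *\<^sub>R (y i - ymean)) = 0"
  using weight_sum_pos unfolding ymean_def by (intro sum_weighted_deviation) simp

lemma v_deviation: "(\<Sum>i=1..k. w i *\<^sub>R (v i - vmean)) = 0"
  using weight_sum_pos unfolding vmean_def by (intro sum_weighted_deviation) simp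

text \<open>
  The covariance of the \<open>y i\<close> and \<open>v i\<close> that \<open>emean\<close> contains is exactly the error that arises when
  averaging is exchanged with the bilinear pairing.
\<close>

lemma vmean_in_enlargement: "vmean \<in> enlargement T emean ymean"
  unfolding enlargement_def
proof (intro CollectI allI ballI)
  fix z q assume q: "q \<in> T z"
  let ?W = "sum w {1..k}"
  have "- \<epsilon> i \<le> (q - v i) \<bullet> (z - y i)" for i
    using inclusion[of i] q unfolding gph_def enlargement_def by blast
  hence "(\<Sum>i=1..k. w i * (- \<epsilon> i)) \<le> (\<Sum>i=1..k. w i * ((q - v i) \<bullet> (z - y i)))"
    using w_nonneg by (intro sum_mono mult_left_mono) auto
  also have "\<dots> = (\<Sum>i=1..k. w i * ((q - vmean) \<bullet> (z - ymean))
      - (q - vmean) \<bullet> (w i *\<^sub>R (y i - ymean)) - (w i *\<^sub>R (v i - vmean)) \<bullet> (z - ymean)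
      + w i * ((y i - ymean) \<bullet> (v i - vmean)))"
    by (intro sum.cong refl) (simp add: algebra_simps inner_diff_left inner_diff_right inner_commute)
  also have "\<dots> = ?W * ((q - vmean) \<bullet> (z - ymean))
      + (\<Sum>i=1..k. w i * ((y i - ymean) \<bullet> (v i - vmean)))"
    by (simp only: sum.distrib sum_subtractf y_deviation v_deviation inner_zero_left
        inner_zero_right diff_zero flip: inner_sum_left inner_sum_right sum_distrib_right)
  moreover have "?W * emean = (\<Sum>i=1..k. w i * \<epsilon> i) + (\<Sum>i=1..k. w i * ((y i - ymean) \<bullet> (v i - vmean)))"
    using weight_sum_pos unfolding emean_def by (simp add: distrib_left flip: sum.distrib)
  ultimately have "- (?W * emean) \<le> ?W * ((q - vmean) \<bullet> (z - ymean))"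
    by (simp add: sum_negf)
  hence "?W * (- emean) \<le> ?W * ((q - vmean) \<bullet> (z - ymean))" by simp
  thus "- emean \<le> (q - vmean) \<bullet> (z - ymean)"
    using weight_sum_pos by (subst (asm) mult_le_cancel_left_pos)
qed

lemma emean_eq: "sum w {1..k} * emean = (\<Sum>i=1..k. w i * (\<epsilon> i + v i \<bullet> (y i - ymean)))"
proof -
  have "(\<Sum>i=1..k. w i * (\<epsilon> i + v i \<bullet> (y i - ymean)))
      = (\<Sum>i=1..k. w i * (\<epsilon> i + (y i - ymean) \<bullet> (v i - vmean)) + (w i *\<^sub>R (y i - ymean)) \<bullet> vmean)"
    by (intro sum.cong refl) (simp add: inner_diff_right inner_commute algebra_simps)
  also have "\<dots> = (\<Sum>i=1..k. w i * (\<epsilon> i + (y i - ymean) \<bullet> (v i - vmean)))"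
    by (simp only: sum.distrib y_deviation inner_zero_left add_0_right flip: inner_sum_left)
  finally show ?thesis using weight_sum_pos by (simp add: emean_def)
qed

lemma weighted_v: "w i *\<^sub>R v i = \<alpha> i *\<^sub>R (\<M> i (x i) - \<M> i (x (Suc i)))"
proof -
  have "\<M> i (x i) - \<M> i (x (Suc i)) = (1 + \<theta> i) *\<^sub>R \<M> i (u i)"
    by (simp add: x_Suc linear_diff[OF linear_M] linear_scale[OF linear_M])
  thus ?thesis by (simp add: M_u w_def mult_ac)
qed

lemma k_eq_Suc: obtains n where "k = Suc n"
  using alpha_sum_pos by (cases k) auto

lemma alpha_le_Max: "i \<in> {1..k} \<Longrightarrow> \<alpha> i \<le> (MAX i\<in>{1..k}. \<alpha> i)"
  by (intro Max_ge) auto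

lemma alpha_Max_nonneg: "0 \<le> (MAX i\<in>{1..k}. \<alpha> i)"
proof -
  have "1 \<in> {1..k}" by (rule k_eq_Suc) auto
  from alpha_le_Max[OF this] show ?thesis using alpha_nonneg[of 1] by linarith
qed

end

section \<open>Ergodic means for two-sided variation of the metrics\<close>

locale vmor_hpe_means_two_sided = vmor_hpe_means +
  assumes M_le_Suc: "\<And>j. \<M> j \<preceq> (\<lambda>z. (1 + \<xi> j) *\<^sub>R \<M> (Suc j) z)"
begin

lemma form_le_Suc: "z \<bullet> \<M> i z \<le> (1 + \<xi> i) * (z \<bullet> \<M> (Suc i) z)"
  using M_le_Suc[of i] by (simp add: loewner_le_def inner_diff_right)

lemma metric_variation:
  "\<bar>z \<bullet> (\<M> (Suc i) z - \<M> i z)\<bar> \<le> \<xi> i * (z \<bullet> \<M> i z)"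
proof -
  have "\<xi> i * (z \<bullet> \<M> (Suc i) z) \<le> \<xi> i * (z \<bullet> \<M> i z)" if "z \<bullet> \<M> (Suc i) z \<le> z \<bullet> \<M> i z"
    using that xi_nonneg by (rule mult_left_mono)
  moreover have "0 \<le> \<xi> i * (z \<bullet> \<M> i z)"
    using xi_nonneg positive_M by (simp add: positive_op_def)
  ultimately show ?thesis
    using M_Suc_le[of z i] form_le_Suc[of z i]
    by (cases "z \<bullet> \<M> (Suc i) z \<le> z \<bullet> \<M> i z") (auto simp: inner_diff_right distrib_right abs_le_iff)
qed

lemma norm_metric_variation:
  "norm (\<M> (Suc i) z - \<M> i z) \<le> \<xi> i * (\<Xi> * \<omega>\<^sub>u * norm z)"
proof -
  have "norm (\<M> (Suc i) z - \<M> i z) \<le> (\<xi> i * (\<Xi> * \<omega>\<^sub>u)) * norm z"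
  proof (rule norm_le_of_quadratic_form_le)
    show "self_adjoint (\<lambda>z. \<M> (Suc i) z - \<M> i z)"
      using M_self_adjoint by (intro self_adjoint_diff)
    show "0 \<le> \<xi> i * (\<Xi> * \<omega>\<^sub>u)" using xi_nonneg[of i] Xi_ge_1 omega_u_pos by simp
    fix z
    have "\<bar>z \<bullet> (\<M> (Suc i) z - \<M> i z)\<bar> \<le> \<xi> i * (z \<bullet> \<M> i z)" by (rule metric_variation)
    also have "\<dots> \<le> \<xi> i * (\<Xi> * \<omega>\<^sub>u * (norm z)\<^sup>2)"
      using M_upper xi_nonneg by (rule mult_left_mono)
    finally show "\<bar>z \<bullet> (\<M> (Suc i) z - \<M> i z)\<bar> \<le> \<xi> i * (\<Xi> * \<omega>\<^sub>u) * (norm z)\<^sup>2"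
      by (simp add: mult.assoc)
  qed
  thus ?thesis by (simp add: mult.assoc)
qed

lemma inner_metric_variation:
  "\<bar>p \<bullet> (\<M> (Suc i) z - \<M> i z)\<bar> \<le> \<xi> i * (norm_op (\<M> i) p * norm_op (\<M> i) z)"
  by (rule bilinear_form_le_norm_op[where N = "\<lambda>z. \<M> (Suc i) z - \<M> i z"])
    (simp_all add: self_adjoint_diff M_self_adjoint positive_M xi_nonneg metric_variation)

lemma growth_le_M:
  assumes "i \<le> j"
  shows "growth i * (z \<bullet> \<M> i z) \<le> growth j * (z \<bullet> \<M> j z)"
  using assms
proof (induction j rule: dec_induct)
  case (step j)
  have "growth j * (z \<bullet> \<M> j z) \<le> growth j * ((1 + \<xi> j) * (z \<bullet> \<M> (Suc j) z))"
    using form_le_Suc growth_ge_1[of j] by (intro mult_left_mono) auto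
  thus ?case using step.IH by (simp add: growth_Suc mult_ac)
qed simp

text \<open>
  Two metrics differ at most by the factor between the growths at their indices, whichever comes
  first; bounding the larger of the two growths by \<open>\<Xi>\<close> gives a symmetric form.
\<close>

lemma metric_comparison:
  "growth i * growth j * (z \<bullet> \<M> i z) \<le> \<Xi>\<^sup>2 * (z \<bullet> \<M> j z)"
proof -
  have q: "0 \<le> z \<bullet> \<M> i z" for i using positive_M by (simp add: positive_op_def)
  have g: "0 \<le> growth i" for i using growth_ge_1[of i] by linarith
  have sq: "growth i * growth i * (z \<bullet> \<M> j z) \<le> \<Xi>\<^sup>2 * (z \<bullet> \<M> j z)" for i
    using growth_le_Xi[of i] g[of i] q by (simp add: power2_eq_square mult_mono mult_right_mono)
  show ?thesis
  proof (cases "j \<le> i")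
    case True
    have "growth i * (growth j * (z \<bullet> \<M> i z)) \<le> growth i * (growth i * (z \<bullet> \<M> j z))"
      using M_le_growth[OF True] g by (rule mult_left_mono)
    thus ?thesis using sq[of i] by (simp add: mult.assoc)
  next
    case False
    have "growth j * (growth i * (z \<bullet> \<M> i z)) \<le> growth j * (growth j * (z \<bullet> \<M> j z))"
      using growth_le_M[of i j z] False g by (intro mult_left_mono) auto
    thus ?thesis using sq[of j] by (simp add: mult_ac)
  qed
qed

text \<open>
  By \<open>weighted_v\<close> the mean is built from the weighted differences \<open>\<M> i (x i) - \<M> i (x (Suc i))\<close>, in which only the
  metric separates the end of one iteration from the start of the next.
\<close>

lemma vmean_bound:
  "norm vmean \<le>
    ((MAX i\<in>{1..k}. \<alpha> (i + 1)) * (\<Sum>i=1..k. \<xi> i)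
       + (\<Sum>i=1..k. \<bar>\<alpha> i - \<alpha> (i + 1)\<bar>) + \<alpha> (k + 1) + \<alpha> 1)
    / (c\<^sub>l * (1 + \<theta>\<^sub>l) * (\<Sum>i=1..k. \<alpha> i)) * (\<Xi> * \<omega>\<^sub>u * (norm xs + sqrt (\<Xi> / \<omega>\<^sub>l) * D))"
proof -
  obtain n where n: "k = Suc n" by (rule k_eq_Suc)
  let ?K = "\<Xi> * \<omega>\<^sub>u * (norm xs + sqrt (\<Xi> / \<omega>\<^sub>l) * D)"
  let ?A = "MAX i\<in>{1..k}. \<alpha> (i + 1)"
  let ?R = "\<alpha> 1 + \<alpha> (Suc n) + (\<Sum>i=1..n. \<alpha> (Suc i) * \<xi> i + \<bar>\<alpha> (Suc i) - \<alpha> i\<bar>)"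
  let ?N = "?A * (\<Sum>i=1..k. \<xi> i) + (\<Sum>i=1..k. \<bar>\<alpha> i - \<alpha> (i + 1)\<bar>) + \<alpha> (k + 1) + \<alpha> 1"
  have Xu: "0 \<le> \<Xi> * \<omega>\<^sub>u" using Xi_ge_1 omega_u_pos by simp
  have xK: "\<Xi> * \<omega>\<^sub>u * norm (x i) \<le> ?K" for i
    using norm_x_le Xu by (rule mult_left_mono)
  have MK: "norm (\<M> i (x j)) \<le> ?K" for i j
    using norm_M_le xK by (rule order_trans)
  have gap: "norm (\<M> (Suc i) (x (Suc i)) - \<M> i (x (Suc i))) \<le> \<xi> i * ?K" for i
    using norm_metric_variation mult_left_mono[OF xK xi_nonneg] by (rule order_trans)
  have K0: "0 \<le> ?K" using MK norm_ge_zero by (rule order_trans[rotated])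
  have sum: "norm (\<Sum>i=1..k. w i *\<^sub>R v i) \<le> ?R * ?K"
    unfolding weighted_v n using alpha_nonneg MK gap by (intro norm_weighted_sum_by_parts_le) auto
  have A: "\<alpha> (Suc i) \<le> ?A" if "i \<in> {1..k}" for i
    using that by (intro Max_ge) auto
  have A0: "0 \<le> ?A" using n by (intro order_trans[OF alpha_nonneg A[of 1]]) auto
  have "(\<Sum>i=1..n. \<alpha> (Suc i) * \<xi> i) \<le> (\<Sum>i=1..n. ?A * \<xi> i)"
    using A xi_nonneg unfolding n by (intro sum_mono mult_right_mono) auto
  hence "(\<Sum>i=1..n. \<alpha> (Suc i) * \<xi> i) \<le> ?A * (\<Sum>i=1..n. \<xi> i)"
    by (simp add: sum_distrib_left)
  also have "\<dots> \<le> ?A * (\<Sum>i=1..k. \<xi> i)"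
    using A0 xi_nonneg n by (intro mult_left_mono) auto
  finally have "?R \<le> ?N"
    by (simp add: n sum.distrib abs_minus_commute)
  hence "?R * ?K \<le> ?N * ?K" using K0 by (rule mult_right_mono)
  hence "norm (\<Sum>i=1..k. w i *\<^sub>R v i) \<le> ?N * ?K" using sum by linarith
  moreover have "norm vmean = norm (\<Sum>i=1..k. w i *\<^sub>R v i) / sum w {1..k}"
    using weight_sum_pos by (simp add: vmean_def divide_inverse mult.commute)
  moreover have "0 \<le> ?N * ?K" using calculation(1) norm_ge_zero by (rule order_trans[rotated])
  ultimately have "norm vmean \<le> (?N * ?K) / (c\<^sub>l * (1 + \<theta>\<^sub>l) * (\<Sum>i=1..k. \<alpha> i))"
    using weight_sum_ge weight_lower_pos by (simp only: frac_le)
  thus ?thesis by simp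
qed

text \<open>
  The square of the length of the residual \<open>d j\<close> is at most \<open>r\<close> times the bound on the squared
  distance of \<open>x j\<close> to \<open>xs\<close>.
\<close>

definition r :: real where
  "r = 1 / ((1 + \<theta>\<^sub>l) * (1 - \<sigma>))"

lemma r_pos: "0 < r"
  using theta_l sigma by (simp add: r_def)

lemma norm_op_distance_le:
  "norm_op (\<M> i) (x i - xs) \<le> sqrt (growth i) * D"
  "norm_op (\<M> i) (x (Suc i) - xs) \<le> sqrt (growth i) * D"
proof -
  have "norm_op (\<M> i) z \<le> sqrt (growth i) * D" if "z \<bullet> \<M> i z \<le> growth i * D\<^sup>2" for z
    using real_sqrt_le_mono[OF that] D_nonneg by (simp add: norm_op_def real_sqrt_mult)
  thus "norm_op (\<M> i) (x i - xs) \<le> sqrt (growth i) * D"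
    "norm_op (\<M> i) (x (Suc i) - xs) \<le> sqrt (growth i) * D"
    using distance_le_growth distance_Suc_le_growth by blast+
qed

lemma norm_op_y_le: "norm_op (\<M> j) (y j - xs) \<le> (1 + sqrt r) * (sqrt (growth j) * D)"
proof -
  have "d j \<bullet> \<M> j (d j) \<le> r * (growth j * D\<^sup>2)"
    using residual_le_growth[of j] theta_l sigma by (simp add: r_def pos_le_divide_eq mult.commute)
  hence "norm_op (\<M> j) (d j) \<le> sqrt r * (sqrt (growth j) * D)"
    using real_sqrt_le_mono D_nonneg by (fastforce simp: norm_op_def real_sqrt_mult)
  moreover have "norm_op (\<M> j) (y j - xs) \<le> norm_op (\<M> j) (x j - xs) + norm_op (\<M> j) (d j)"
    using norm_op_triangle[OF positive_M, of j "x j - xs" "d j"] by (simp add: d_def)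
  ultimately show ?thesis
    using norm_op_distance_le(1)[of j] by (simp add: distrib_right)
qed

lemma norm_op_y_le': "sqrt (growth i) * norm_op (\<M> i) (y j - xs) \<le> (1 + sqrt r) * \<Xi> * D"
proof -
  let ?z = "y j - xs"
  have g: "0 < growth j" using growth_ge_1[of j] by linarith
  have "sqrt (growth i * growth j * (?z \<bullet> \<M> i ?z)) \<le> sqrt (\<Xi>\<^sup>2 * (?z \<bullet> \<M> j ?z))"
    using metric_comparison by (rule real_sqrt_le_mono)
  hence "sqrt (growth j) * (sqrt (growth i) * norm_op (\<M> i) ?z) \<le> \<Xi> * norm_op (\<M> j) ?z"
    using Xi_ge_1 by (simp add: norm_op_def real_sqrt_mult mult_ac)
  also have "\<dots> \<le> \<Xi> * ((1 + sqrt r) * (sqrt (growth j) * D))"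
    using norm_op_y_le Xi_ge_1 by (intro mult_left_mono) auto
  finally have "sqrt (growth j) * (sqrt (growth i) * norm_op (\<M> i) ?z)
      \<le> sqrt (growth j) * ((1 + sqrt r) * \<Xi> * D)"
    by (simp add: mult_ac)
  thus ?thesis using g by simp
qed

lemma norm_op_ymean_le: "sqrt (growth i) * norm_op (\<M> i) (ymean - xs) \<le> (1 + sqrt r) * \<Xi> * D"
proof -
  let ?W = "sum w {1..k}" and ?L = "(1 + sqrt r) * \<Xi> * D / sqrt (growth i)"
  have g: "0 < sqrt (growth i)" using growth_ge_1[of i] by simp
  have "(\<Sum>j=1..k. (w j / ?W) *\<^sub>R (y j - xs)) = (\<Sum>j=1..k. w j *\<^sub>R (y j - xs)) /\<^sub>R ?W"
    by (simp add: scaleR_right.sum divide_inverse mult.commute)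
  also have "(\<Sum>j=1..k. w j *\<^sub>R (y j - xs)) = (\<Sum>j=1..k. w j *\<^sub>R y j) - ?W *\<^sub>R xs"
    by (simp add: scaleR_diff_right sum_subtractf scaleR_left.sum)
  finally have "ymean - xs = (\<Sum>j=1..k. (w j / ?W) *\<^sub>R (y j - xs))"
    using weight_sum_pos by (simp add: ymean_def scaleR_diff_right)
  moreover have "norm_op (\<M> i) (\<Sum>j=1..k. (w j / ?W) *\<^sub>R (y j - xs)) \<le> (\<Sum>j=1..k. w j / ?W) * ?L"
    using norm_op_y_le'[of i] g w_nonneg weight_sum_pos
    by (intro norm_op_weighted_sum_le[OF positive_M]) (auto simp: pos_le_divide_eq mult.commute)
  moreover have "(\<Sum>j=1..k. w j / ?W) = 1"
    using weight_sum_pos by (simp flip: sum_divide_distrib)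
  ultimately show ?thesis using g by (simp add: pos_le_divide_eq mult.commute)
qed

text \<open>
  Summing the energy estimate with \<open>z = ymean\<close> and expanding the squares around \<open>xs\<close>, the terms
  quadratic in \<open>ymean - xs\<close> cancel.  The terms quadratic in the iterates are bounded by the total
  decrease of the distance to \<open>xs\<close>, and the mixed terms are summed by parts.  In a mixed term the bound
  on the distance of the iterate grows with the square root of \<open>growth i\<close>, whereas the bound on \<open>ymean - xs\<close> decays
  at the same rate, so that only one factor \<open>\<Xi>\<close> remains.
\<close>

lemma weighted_emean_le:
  "2 * (sum w {1..k} * emean)
    \<le> (MAX i\<in>{1..k}. \<alpha> i) * (1 + (\<Sum>i=1..k. \<xi> i)) * (\<Xi> * D\<^sup>2)
      + 2 * (2 * ((MAX i\<in>{1..k}. \<alpha> i) * (1 + (\<Sum>i=1..k. \<xi> i))) + (\<Sum>i=1..k. \<bar>\<alpha> (i + 1) - \<alpha> i\<bar>))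
        * ((1 + sqrt r) * (\<Xi> * D\<^sup>2))"
proof -
  obtain n where n: "k = Suc n" by (rule k_eq_Suc)
  let ?A = "MAX i\<in>{1..k}. \<alpha> i" and ?S = "1 + (\<Sum>i=1..k. \<xi> i)" and ?F = "\<Xi> * D\<^sup>2"
  let ?V = "\<Sum>i=1..k. \<bar>\<alpha> (i + 1) - \<alpha> i\<bar>" and ?K = "(1 + sqrt r) * (\<Xi> * D\<^sup>2)"
  let ?p = "ymean - xs"
  define a where "a i = (x i - xs) \<bullet> \<M> i (x i - xs)" for i
  define b where "b i = (x (Suc i) - xs) \<bullet> \<M> i (x (Suc i) - xs)" for i
  define g where "g i = ?p \<bullet> \<M> i (x i - xs)" for i
  define h where "h i = ?p \<bullet> \<M> i (x (Suc i) - xs)" for i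
  have F0: "0 \<le> ?F" using Xi_ge_1 by simp
  have K0: "0 \<le> ?K" using F0 r_pos by simp
  have A: "\<alpha> i \<le> ?A" if "i \<in> {1..k}" for i using that by (rule alpha_le_Max)
  have A0: "0 \<le> ?A" by (rule alpha_Max_nonneg)

  have energy: "2 * (w i * (\<epsilon> i + v i \<bullet> (y i - ymean))) \<le> \<alpha> i * (a i - b i) - 2 * (\<alpha> i * (g i - h i))"
    if "1 \<le> i" for i
  proof -
    \<comment> \<open>The last summand does not depend on \<open>z\<close>: it cancels in the difference for \<open>x i\<close>, \<open>x (Suc i)\<close>.\<close>
    have shift: "(z - ymean) \<bullet> \<M> i (z - ymean)
        = (z - xs) \<bullet> \<M> i (z - xs) - 2 * (?p \<bullet> \<M> i (z - xs)) + ?p \<bullet> \<M> i ?p" for z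
      using quadratic_form_diff[OF M_self_adjoint, of "z - xs" ?p i]
        self_adjoint_inner[OF M_self_adjoint, of i ?p "z - xs"] by (simp add: inner_commute)
    have "0 \<le> (1 + \<theta> i) * (1 - \<sigma>) * (d i \<bullet> \<M> i (d i))"
      using theta_pos[of i] sigma positive_M[of i] by (simp add: positive_op_def)
    hence "(a i - b i) - 2 * (g i - h i) \<ge> (x i - ymean) \<bullet> \<M> i (x i - ymean)
        - (x (Suc i) - ymean) \<bullet> \<M> i (x (Suc i) - ymean) - (1 + \<theta> i) * (1 - \<sigma>) * (d i \<bullet> \<M> i (d i))"
      by (simp add: shift a_def b_def g_def h_def)
    hence "2 * ((1 + \<theta> i) * c i) * (\<epsilon> i + v i \<bullet> (y i - ymean)) \<le> (a i - b i) - 2 * (g i - h i)"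
      using energy_decrease by (rule order_trans[rotated])
    from mult_left_mono[OF this alpha_nonneg[OF that]] show ?thesis
      by (simp add: w_def algebra_simps)
  qed
  have "2 * (sum w {1..k} * emean) = (\<Sum>i=1..k. 2 * (w i * (\<epsilon> i + v i \<bullet> (y i - ymean))))"
    unfolding emean_eq by (simp add: sum_distrib_left)
  also have "\<dots> \<le> (\<Sum>i=1..k. \<alpha> i * (a i - b i) - 2 * (\<alpha> i * (g i - h i)))"
    using energy by (intro sum_mono) auto
  also have "\<dots> = (\<Sum>i=1..k. \<alpha> i * (a i - b i)) - 2 * (\<Sum>i=1..k. \<alpha> i * (g i - h i))"
    by (simp add: sum_subtractf sum_distrib_left)
  finally have split: "2 * (sum w {1..k} * emean) \<le> \<dots>" .

  have "(\<Sum>i=1..k. \<alpha> i * (a i - b i)) \<le> (\<Sum>i=1..k. ?A * (a i - b i))"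
    using A distance_antimono by (intro sum_mono mult_right_mono) (auto simp: a_def b_def)
  also have "\<dots> \<le> ?A * (?S * ?F)"
    using mult_left_mono[OF sum_distance_decrease_le[of n] A0]
    by (simp only: a_def b_def n flip: sum_distrib_left)
  finally have quadratic: "(\<Sum>i=1..k. \<alpha> i * (a i - b i)) \<le> ?A * ?S * ?F" by (simp add: mult.assoc)

  have mixed: "norm_op (\<M> i) ?p * norm_op (\<M> i) z \<le> ?K"
    if "norm_op (\<M> i) z \<le> sqrt (growth i) * D" for i z
  proof -
    have "norm_op (\<M> i) ?p * norm_op (\<M> i) z \<le> norm_op (\<M> i) ?p * (sqrt (growth i) * D)"
      using that positive_M by (intro mult_left_mono norm_op_nonneg)
    also have "\<dots> \<le> ((1 + sqrt r) * \<Xi> * D) * D"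
      using mult_right_mono[OF norm_op_ymean_le D_nonneg, of i] by (simp add: mult_ac)
    finally show ?thesis by (simp add: power2_eq_square mult_ac)
  qed
  have "norm (\<Sum>i=1..Suc n. \<alpha> i *\<^sub>R (g i - h i))
      \<le> (\<alpha> 1 + \<alpha> (Suc n) + (\<Sum>i=1..n. \<alpha> (Suc i) * \<xi> i + \<bar>\<alpha> (Suc i) - \<alpha> i\<bar>)) * ?K"
  proof (rule norm_weighted_sum_by_parts_le)
    show "0 \<le> \<alpha> i" if "1 \<le> i" for i using that by (rule alpha_nonneg)
    show "norm (g 1) \<le> ?K"
      using inner_le_norm_op[OF positive_M] mixed[OF norm_op_distance_le(1)]
      unfolding g_def real_norm_def by (rule order_trans)
    show "norm (h i) \<le> ?K" for i
      using inner_le_norm_op[OF positive_M] mixed[OF norm_op_distance_le(2)]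
      unfolding h_def real_norm_def by (rule order_trans)
    show "norm (g (Suc i) - h i) \<le> \<xi> i * ?K" for i
      using inner_metric_variation mult_left_mono[OF mixed[OF norm_op_distance_le(2)] xi_nonneg]
      unfolding g_def h_def real_norm_def inner_diff_right[symmetric] by (rule order_trans)
  qed
  also have "\<dots> \<le> (2 * (?A * ?S) + ?V) * ?K"
  proof (rule mult_right_mono[OF _ K0])
    have "(\<Sum>i=1..n. \<alpha> (Suc i) * \<xi> i) \<le> (\<Sum>i=1..n. ?A * \<xi> i)"
      using A xi_nonneg n by (intro sum_mono mult_right_mono) auto
    hence "(\<Sum>i=1..n. \<alpha> (Suc i) * \<xi> i) \<le> ?A * (\<Sum>i=1..n. \<xi> i)"
      by (simp add: sum_distrib_left)
    also have "\<dots> \<le> ?A * (\<Sum>i=1..k. \<xi> i)"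
      using A0 xi_nonneg n by (intro mult_left_mono) auto
    finally have 1: "(\<Sum>i=1..n. \<alpha> (Suc i) * \<xi> i) \<le> ?A * (\<Sum>i=1..k. \<xi> i)" .
    have 2: "(\<Sum>i=1..n. \<bar>\<alpha> (Suc i) - \<alpha> i\<bar>) \<le> ?V" by (simp add: n)
    have 3: "0 \<le> ?A * (\<Sum>i=1..k. \<xi> i)" using A0 xi_nonneg by (simp add: sum_nonneg)
    have "\<alpha> 1 \<le> ?A" "\<alpha> (Suc n) \<le> ?A" using A n by auto
    thus "\<alpha> 1 + \<alpha> (Suc n) + (\<Sum>i=1..n. \<alpha> (Suc i) * \<xi> i + \<bar>\<alpha> (Suc i) - \<alpha> i\<bar>) \<le> 2 * (?A * ?S) + ?V"
      unfolding sum.distrib distrib_left using 1 2 3 by linarith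
  qed
  finally have "\<bar>\<Sum>i=1..k. \<alpha> i * (g i - h i)\<bar> \<le> (2 * (?A * ?S) + ?V) * ?K"
    by (simp add: n)
  thus ?thesis using split quadratic unfolding mult.assoc[of 2] by linarith
qed

text \<open>
  If \<open>r < 1\<close>, then the error criterion forces every iteration to be stationary.  Otherwise
  \<open>sqrt r \<le> r\<close>, and \<open>(5 + 4 * r) / 2 \<le> 1 / (1 - \<sigma>) + 9 * r\<close> and \<open>1 + r \<le> 1 / (1 - \<sigma>) + r\<close> compare the
  coefficients of the two summands.
\<close>

lemma emean_bound:
  "emean \<le> ((10 + \<theta>\<^sub>l) * (MAX i\<in>{1..k}. \<alpha> i) * (1 + (\<Sum>i=1..k. \<xi> i))
              + (2 + \<theta>\<^sub>l) * (\<Sum>i=1..k. \<bar>\<alpha> (i + 1) - \<alpha> i\<bar>))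
            / (c\<^sub>l * (1 + \<theta>\<^sub>l)\<^sup>2 * (\<Sum>i=1..k. \<alpha> i)) * (\<Xi> / (1 - \<sigma>) * D\<^sup>2)"
proof -
  define A where "A = (MAX i\<in>{1..k}. \<alpha> i) * (1 + (\<Sum>i=1..k. \<xi> i))"
  define V where "V = (\<Sum>i=1..k. \<bar>\<alpha> (i + 1) - \<alpha> i\<bar>)"
  define F where "F = \<Xi> * D\<^sup>2"
  define t where "t = 1 / (1 - \<sigma>)"
  define W' where "W' = c\<^sub>l * (1 + \<theta>\<^sub>l) * (\<Sum>i=1..k. \<alpha> i)"
  let ?W = "sum w {1..k}"
  have A0: "0 \<le> A" using alpha_Max_nonneg xi_nonneg by (simp add: A_def sum_nonneg add_nonneg_nonneg)
  have V0: "0 \<le> V" by (simp add: V_def sum_nonneg)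
  have F0: "0 \<le> F" using Xi_ge_1 by (simp add: F_def)
  have t1: "1 \<le> t" using sigma by (simp add: t_def)
  have W: "0 < W'" "W' \<le> ?W" using weight_lower_pos weight_sum_ge by (simp_all add: W'_def)
  have h: "0 < 1 + \<theta>\<^sub>l" and s: "0 < 1 - \<sigma>" using theta_l sigma by simp_all
  have tr: "t = (1 + \<theta>\<^sub>l) * r" using h by (simp add: t_def r_def)
  define R where "R = A * (t + 9 * r) + V * (t + r)"
  have "((10 + \<theta>\<^sub>l) * A + (2 + \<theta>\<^sub>l) * V) * r = R"
    unfolding R_def tr by (simp add: algebra_simps)
  moreover have "((10 + \<theta>\<^sub>l) * A + (2 + \<theta>\<^sub>l) * V) / (c\<^sub>l * (1 + \<theta>\<^sub>l)\<^sup>2 * (\<Sum>i=1..k. \<alpha> i)) * (\<Xi> / (1 - \<sigma>) * D\<^sup>2)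
      = ((10 + \<theta>\<^sub>l) * A + (2 + \<theta>\<^sub>l) * V) * r * F / W'"
    by (simp add: r_def F_def W'_def power2_eq_square mult_ac)
  ultimately have rhs: "((10 + \<theta>\<^sub>l) * A + (2 + \<theta>\<^sub>l) * V) / (c\<^sub>l * (1 + \<theta>\<^sub>l)\<^sup>2 * (\<Sum>i=1..k. \<alpha> i))
      * (\<Xi> / (1 - \<sigma>) * D\<^sup>2) = R * F / W'" by simp
  have R0: "0 \<le> R * F" using A0 V0 F0 t1 r_pos by (simp add: R_def)
  have "?W * emean \<le> R * F"
  proof (cases "r < 1")
    case True
    have "1 < (1 + \<theta> i) * (1 - \<sigma>)" for i
    proof -
      have "1 < (1 + \<theta>\<^sub>l) * (1 - \<sigma>)" using True h s by (simp add: r_def pos_divide_less_eq)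
      also have "\<dots> \<le> (1 + \<theta> i) * (1 - \<sigma>)" using theta_ge[of i] s by simp
      finally show ?thesis .
    qed
    hence "?W * emean = 0" unfolding emean_eq by (simp add: stationary_if_overrelaxed)
    thus ?thesis using R0 by (simp only:)
  next
    case False
    hence "sqrt r \<le> r" by (simp add: real_le_lsqrt sqrt_le_D power2_eq_square real_sqrt_le_iff)
    hence K: "(1 + sqrt r) * F \<le> (1 + r) * F" using F0 by (intro mult_right_mono) auto
    have "2 * (?W * emean) \<le> A * F + 2 * (2 * A + V) * ((1 + sqrt r) * F)"
      using weighted_emean_le by (simp add: A_def V_def F_def)
    also have "\<dots> \<le> A * F + 2 * (2 * A + V) * ((1 + r) * F)"
      using K A0 V0 by (intro add_left_mono mult_left_mono) auto
    also have "\<dots> = (A * (5 + 4 * r) + V * (2 + 2 * r)) * F"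
      by (simp add: algebra_simps)
    also have "\<dots> \<le> (A * (2 * (t + 9 * r)) + V * (2 * (t + r))) * F"
      using A0 V0 F0 t1 False by (intro mult_right_mono add_mono mult_left_mono) auto
    also have "\<dots> = 2 * (R * F)" by (simp add: R_def algebra_simps)
    finally show ?thesis by simp
  qed
  hence "emean \<le> R * F / ?W" using W by (simp add: pos_le_divide_eq mult.commute)
  also have "\<dots> \<le> R * F / W'" using R0 W by (intro divide_left_mono) auto
  finally show ?thesis unfolding rhs[symmetric] by (simp add: A_def V_def mult.assoc)
qed

end

section \<open>Complexity of the framework\<close>

theorem theorem3:
  fixes T :: "'a::euclidean_space \<Rightarrow> 'a set"
    and \<omega>\<^sub>l \<omega>\<^sub>u \<theta>\<^sub>l \<sigma> c\<^sub>l :: real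
    and \<xi> :: "nat \<Rightarrow> real"
    and \<M> :: "nat \<Rightarrow> 'a \<Rightarrow> 'a"
    and c \<theta> \<epsilon> :: "nat \<Rightarrow> real"
    and x y v :: "nat \<Rightarrow> 'a"
    and xs :: 'a
    and k :: nat
  assumes "maximal_monotone T"
    and "0 \<in> T xs"
    and "vmor_hpe T \<omega>\<^sub>l \<omega>\<^sub>u \<theta>\<^sub>l \<sigma> c\<^sub>l \<xi> \<M> c \<theta> \<epsilon> x y v"
    and "k \<ge> 1"
  shows
    "let \<Xi> = (\<Prod>i. 1 + \<xi> i);
         D = norm_op (\<M> 0) (x 0 - xs)
     in
      (\<exists>k\<^sub>0 \<in> {1..k}.
          v k\<^sub>0 \<in> enlargement T (\<epsilon> k\<^sub>0) (y k\<^sub>0) \<and> \<epsilon> k\<^sub>0 \<ge> 0 \<and>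
          norm (v k\<^sub>0) \<le> sqrt (4 * (1 + (\<Sum>i=1..k. \<xi> i)) * \<Xi>\<^sup>2 * \<omega>\<^sub>u
                              / (real k * (1 - \<sigma>) * (1 + \<theta>\<^sub>l) ^ 3 * c\<^sub>l\<^sup>2)) * D \<and>
          \<epsilon> k\<^sub>0 \<le> (1 + (\<Sum>i=1..k. \<xi> i)) * \<Xi>
                    / (real k * (1 - \<sigma>) * (1 + \<theta>\<^sub>l)\<^sup>2 * c\<^sub>l) * D\<^sup>2)
      \<and>
      (\<forall>\<alpha> :: nat \<Rightarrow> real. (\<forall>i\<ge>1. \<alpha> i \<ge> 0) \<and> (\<Sum>i=1..k. \<alpha> i) > 0 \<longrightarrow>
        (let \<tau> = (\<lambda>i. (1 + \<theta> i) * c i);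
             W = (\<Sum>i=1..k. \<tau> i * \<alpha> i);
             ybar = (\<Sum>i=1..k. (\<tau> i * \<alpha> i) *\<^sub>R y i) /\<^sub>R W;
             vbar = (\<Sum>i=1..k. (\<tau> i * \<alpha> i) *\<^sub>R v i) /\<^sub>R W;
             \<epsilon>bar = (\<Sum>i=1..k. \<tau> i * \<alpha> i * (\<epsilon> i + (y i - ybar) \<bullet> (v i - vbar))) / W;
             M = \<Xi> * \<omega>\<^sub>u * (norm xs + sqrt (\<Xi> / \<omega>\<^sub>l) * D);
             B = Max {M,
                      \<Xi> * (norm xs)\<^sup>2 + \<Xi>\<^sup>2 / \<omega>\<^sub>l * D\<^sup>2,
                      \<Xi>\<^sup>2 / ((1 - \<sigma>) * \<omega>\<^sub>l) * D\<^sup>2,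
                      \<Xi> / (1 - \<sigma>) * D\<^sup>2}
         in
          vbar \<in> enlargement T \<epsilon>bar ybar \<and> \<epsilon>bar \<ge> 0 \<and>
          ((\<forall>j. \<M> j \<preceq> (\<lambda>z. (1 + \<xi> j) *\<^sub>R \<M> (Suc j) z)) \<longrightarrow>
            norm vbar \<le>
              ((MAX i\<in>{1..k}. \<alpha> (i + 1)) * (\<Sum>i=1..k. \<xi> i)
                 + (\<Sum>i=1..k. \<bar>\<alpha> i - \<alpha> (i + 1)\<bar>) + \<alpha> (k + 1) + \<alpha> 1)
              / (c\<^sub>l * (1 + \<theta>\<^sub>l) * (\<Sum>i=1..k. \<alpha> i)) * M \<and>
            \<epsilon>bar \<le>
              ((10 + \<theta>\<^sub>l) * (MAX i\<in>{1..k}. \<alpha> i) * (1 + (\<Sum>i=1..k. \<xi> i))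
                 + (2 + \<theta>\<^sub>l) * (\<Sum>i=1..k. \<bar>\<alpha> (i + 1) - \<alpha> i\<bar>))
              / (c\<^sub>l * (1 + \<theta>\<^sub>l)\<^sup>2 * (\<Sum>i=1..k. \<alpha> i)) * B)))"
proof -
  interpret vmor_hpe_zero T \<omega>\<^sub>l \<omega>\<^sub>u \<theta>\<^sub>l \<sigma> c\<^sub>l \<xi> \<M> c \<theta> \<epsilon> x y v xs
    using assms(2,3) by (simp add: vmor_hpe_zero_def vmor_hpe_zero_axioms_def)
  show ?thesis
    unfolding Let_def \<Xi>_def[symmetric] D_def[symmetric]
  proof (intro conjI allI impI, goal_cases)
    case 1
    show ?case using assms(4) by (rule pointwise_complexity)
  next
    case (2 \<alpha>)
    then interpret m: vmor_hpe_means T \<omega>\<^sub>l \<omega>\<^sub>u \<theta>\<^sub>l \<sigma> c\<^sub>l \<xi> \<M> c \<theta> \<epsilon> x y v xs \<alpha> k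
      by unfold_locales auto
    show ?case
      unfolding m.w_def[symmetric] m.ymean_def[symmetric] m.vmean_def[symmetric] m.emean_def[symmetric]
      by (rule m.vmean_in_enlargement)
  next
    case (3 \<alpha>)
    then interpret m: vmor_hpe_means T \<omega>\<^sub>l \<omega>\<^sub>u \<theta>\<^sub>l \<sigma> c\<^sub>l \<xi> \<M> c \<theta> \<epsilon> x y v xs \<alpha> k
      by unfold_locales auto
    show ?case
      unfolding m.w_def[symmetric] m.ymean_def[symmetric] m.vmean_def[symmetric] m.emean_def[symmetric]
      using assms(1) m.vmean_in_enlargement by (rule enlargement_nonneg)
  next
    case (4 \<alpha>)
    then interpret m: vmor_hpe_means_two_sided T \<omega>\<^sub>l \<omega>\<^sub>u \<theta>\<^sub>l \<sigma> c\<^sub>l \<xi> \<M> c \<theta> \<epsilon> x y v xs \<alpha> k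
      by unfold_locales auto
    show ?case
      unfolding m.w_def[symmetric] m.ymean_def[symmetric] m.vmean_def[symmetric] m.emean_def[symmetric]
      by (rule m.vmean_bound)
  next
    case (5 \<alpha>)
    then interpret m: vmor_hpe_means_two_sided T \<omega>\<^sub>l \<omega>\<^sub>u \<theta>\<^sub>l \<sigma> c\<^sub>l \<xi> \<M> c \<theta> \<epsilon> x y v xs \<alpha> k
      by unfold_locales auto
    let ?B = "{\<Xi> * \<omega>\<^sub>u * (norm xs + sqrt (\<Xi> / \<omega>\<^sub>l) * D), \<Xi> * (norm xs)\<^sup>2 + \<Xi>\<^sup>2 / \<omega>\<^sub>l * D\<^sup>2,
      \<Xi>\<^sup>2 / ((1 - \<sigma>) * \<omega>\<^sub>l) * D\<^sup>2, \<Xi> / (1 - \<sigma>) * D\<^sup>2}"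
    have "\<Xi> / (1 - \<sigma>) * D\<^sup>2 \<le> Max ?B" by (intro Max_ge) auto
    moreover have "0 \<le> ((10 + \<theta>\<^sub>l) * (MAX i\<in>{1..k}. \<alpha> i) * (1 + (\<Sum>i=1..k. \<xi> i))
          + (2 + \<theta>\<^sub>l) * (\<Sum>i=1..k. \<bar>\<alpha> (i + 1) - \<alpha> i\<bar>))
        / (c\<^sub>l * (1 + \<theta>\<^sub>l)\<^sup>2 * (\<Sum>i=1..k. \<alpha> i))"
    proof (rule divide_nonneg_nonneg)
      have "0 \<le> 1 + (\<Sum>i=1..k. \<xi> i)" "0 \<le> (\<Sum>i=1..k. \<bar>\<alpha> (i + 1) - \<alpha> i\<bar>)"
        using xi_nonneg by (simp_all add: sum_nonneg add_nonneg_nonneg)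
      moreover have "0 \<le> 10 + \<theta>\<^sub>l" "0 \<le> 2 + \<theta>\<^sub>l" using theta_l by simp_all
      ultimately show "0 \<le> (10 + \<theta>\<^sub>l) * (MAX i\<in>{1..k}. \<alpha> i) * (1 + (\<Sum>i=1..k. \<xi> i))
          + (2 + \<theta>\<^sub>l) * (\<Sum>i=1..k. \<bar>\<alpha> (i + 1) - \<alpha> i\<bar>)"
        using m.alpha_Max_nonneg by (simp only: add_nonneg_nonneg mult_nonneg_nonneg)
      show "0 \<le> c\<^sub>l * (1 + \<theta>\<^sub>l)\<^sup>2 * (\<Sum>i=1..k. \<alpha> i)"
        using c_l_pos m.alpha_sum_pos by simp
    qed
    ultimately show ?case
      unfolding m.w_def[symmetric] m.ymean_def[symmetric] m.vmean_def[symmetric] m.emean_def[symmetric]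
      by (rule order_trans[OF m.emean_bound mult_left_mono])
  qed
qed

end
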